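(* Let $m\geq2$ and $p\geq 1$ be integers and let $(\mathcal H_i)_{1\leq i\leq m}$ and $(\mathcal G_k)_{1\leq k\leq p}$ be real Hilbert spaces. For every $i\in\{1,\ldots,m\}$, let $f_i\in\Gamma_0(\mathcal H_i)$ and, for every $k\in\{1,\ldots,p\}$, let $\tau_k\in\left]0,+\infty\right[$, let $\varphi_k\colon\mathcal G_k\to\mathbb R$ be a convex differentiable function with $\tau_k$-Lipschitz continuous gradient, and let $L_{ki}\colon\mathcal H_i\to\mathcal G_k$ be a bounded linear operator. Suppose that $\min_{1\leq k\leq p}\sum_{i=1}^m\|L_{ki}\|^2>0$ and that the problem $$\text{(P)}\quad\underset{x_1\in\mathcal H_1,\ldots,x_m\in\mathcal H_m}{\text{minimize}}\ \ \sum_{i=1}^mf_i(x_i)+\sum_{k=1}^p\varphi_k\bigg(\sum_{i=1}^mL_{ki}x_i\bigg)$$ has at least one solution. Set $$\beta=\frac{1}{p\,\max_{1\leq k\leq p}\tau_k\sum_{i=1}^m\|L_{ki}\|^2}.$$ Fix $\varepsilon\in\left]0,\min\{1,\beta\}\right[$, a sequence $(\gamma_n)_{n\in\mathbb N}$ in $[\varepsilon,2\beta-\varepsilon]$, a sequence $(\lambda_n)_{n\in\mathbb N}$ in $[0,1-\varepsilon]$, and $(x_{i,0})_{1\leq i\leq m}\in\mathcal H_1\times\cdots\times\mathcal H_m$. For every $n\in\mathbb N$ and every $i\in\{1,\ldots,m\}$ set $$x_{i,n+1}=\lambda_{i,n}x_{i,n}+(1-\lambda_{i,n})\Bigg(\operatorname{prox}_{\gamma_nf_{i,n}}\Bigg(x_{i,n}-\gamma_n\bigg(\sum_{k=1}^pL_{ki}^*\nabla\varphi_k\bigg(\sum_{j=1}^mL_{kj}x_{j,n}\bigg)+b_{i,n}\bigg)\Bigg)+a_{i,n}\Bigg),$$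 where, for every $i\in\{1,\ldots,m\}$, the following hold. (i) $(f_{i,n})_{n\in\mathbb N}$ are functions in $\Gamma_0(\mathcal H_i)$ such that $(\forall\rho\in\left]0,+\infty\right[)$ $\sum_{n\in\mathbb N}\sup_{\|y\|\leq\rho}\|\operatorname{prox}_{\gamma_nf_{i,n}}y-\operatorname{prox}_{\gamma_nf_i}y\|<+\infty$. (ii) $(a_{i,n})_{n\in\mathbb N}$ and $(b_{i,n})_{n\in\mathbb N}$ are sequences in $\mathcal H_i$ such that $\sum_{n\in\mathbb N}\|a_{i,n}\|<+\infty$ and $\sum_{n\in\mathbb N}\|b_{i,n}\|<+\infty$. (iii) $(\lambda_{i,n})_{n\in\mathbb N}$ is a sequence in $\left[0,1\right[$ such that $\sum_{n\in\mathbb N}|\lambda_{i,n}-\lambda_n|<+\infty$. Then, for every $i\in\{1,\ldots,m\}$, $(x_{i,n})_{n\in\mathbb N}$ converges weakly to a point $x_i\in\mathcal H_i$, and $(x_i)_{1\leq i\leq m}$ is a solution to (P).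
   Context: $\Gamma_0(\mathcal H)$ is the class of lower semicontinuous convex functions $f\colon\mathcal H\to\left]-\infty,+\infty\right]$ that are proper ($f\not\equiv+\infty$). For $f\in\Gamma_0(\mathcal H)$ and $x\in\mathcal H$, $\operatorname{prox}_fx$ is the unique minimizer of $y\mapsto f(y)+\|x-y\|^2/2$. $L^*$ denotes the adjoint of a bounded linear operator $L$. *)

theory Defs
  imports "HOL-Analysis.Analysis"
begin

text \<open>
  A family of Hilbert spaces of varying type cannot be indexed inside one formula. A real Hilbert
  space is therefore a complete linear subspace of a real inner product space \<open>'a\<close> that is not
  itself assumed to be complete. This is no loss of generality: every family of real Hilbert spaces
  embeds isometrically, as complete subspaces, into its Hilbert direct sum. All notions below are
  intrinsic to the subspace \<open>H\<close>: values of functions and operators outside it are irrelevant.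
\<close>

definition hilbert_subspace :: "'a::real_inner set \<Rightarrow> bool" where
  "hilbert_subspace H \<longleftrightarrow> subspace H \<and> complete H"

definition lsc_on :: "'a::topological_space set \<Rightarrow> ('a \<Rightarrow> ereal) \<Rightarrow> bool" where
  "lsc_on H f \<longleftrightarrow> (\<forall>x\<in>H. f x \<le> Liminf (at x within H) f)"

definition ereal_convex_on :: "'a::real_vector set \<Rightarrow> ('a \<Rightarrow> ereal) \<Rightarrow> bool" where
  "ereal_convex_on H f \<longleftrightarrow>
     (\<forall>x\<in>H. \<forall>y\<in>H. \<forall>t\<in>{0<..<1}.
        f ((1 - t) *\<^sub>R x + t *\<^sub>R y) \<le> ereal (1 - t) * f x + ereal t * f y)"

definition Gamma0 :: "'a::real_inner set \<Rightarrow> ('a \<Rightarrow> ereal) set" where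
  "Gamma0 H = {f. (\<forall>x\<in>H. f x \<noteq> -\<infinity>) \<and> (\<exists>x\<in>H. f x \<noteq> \<infinity>) \<and> lsc_on H f \<and> ereal_convex_on H f}"

definition prox :: "'a::real_inner set \<Rightarrow> ('a \<Rightarrow> ereal) \<Rightarrow> 'a \<Rightarrow> 'a" where
  "prox H f x =
     (THE y. is_arg_min (\<lambda>y. f y + ereal ((norm (x - y))\<^sup>2 / 2)) (\<lambda>y. y \<in> H) y)"

text \<open>
  The derivative is taken along \<open>H\<close> only, and requiring \<open>g \<in> H\<close> makes its representing vector unique.
\<close>

definition gradient :: "'a::real_inner set \<Rightarrow> ('a \<Rightarrow> real) \<Rightarrow> 'a \<Rightarrow> 'a" where
  "gradient H \<phi> x = (THE g. g \<in> H \<and> (\<phi> has_derivative (\<lambda>h. g \<bullet> h)) (at x within H))"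

definition bounded_linear_on ::
    "'a::real_normed_vector set \<Rightarrow> 'b::real_normed_vector set \<Rightarrow> ('a \<Rightarrow> 'b) \<Rightarrow> bool" where
  "bounded_linear_on H G L \<longleftrightarrow>
     L \<in> H \<rightarrow> G \<and>
     (\<forall>x\<in>H. \<forall>y\<in>H. L (x + y) = L x + L y) \<and>
     (\<forall>x\<in>H. \<forall>r. L (r *\<^sub>R x) = r *\<^sub>R L x) \<and>
     (\<exists>K. \<forall>x\<in>H. norm (L x) \<le> K * norm x)"

text \<open>Restriction of \<^const>\<open>onorm\<close> to a subspace; the value is \<open>0\<close> on the zero space.\<close>

definition onorm_on :: "'a::real_normed_vector set \<Rightarrow> ('a \<Rightarrow> 'b::real_normed_vector) \<Rightarrow> real" where
  "onorm_on H L = (SUP x\<in>H. norm (L x) / norm x)"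

definition adjoint_on ::
    "'a::real_inner set \<Rightarrow> ('a \<Rightarrow> 'b::real_inner) \<Rightarrow> 'b \<Rightarrow> 'a" where
  "adjoint_on H L y = (THE x. x \<in> H \<and> (\<forall>z\<in>H. L z \<bullet> y = z \<bullet> x))"

definition weakly_converges_on ::
    "'a::real_inner set \<Rightarrow> (nat \<Rightarrow> 'a) \<Rightarrow> 'a \<Rightarrow> bool" where
  "weakly_converges_on H X l \<longleftrightarrow> l \<in> H \<and> (\<forall>u\<in>H. (\<lambda>n. X n \<bullet> u) \<longlonglongrightarrow> l \<bullet> u)"

definition objective ::
    "nat \<Rightarrow> nat \<Rightarrow> (nat \<Rightarrow> 'a \<Rightarrow> ereal) \<Rightarrow> (nat \<Rightarrow> 'b::real_inner \<Rightarrow> real) \<Rightarrow> (nat \<Rightarrow> nat \<Rightarrow> 'a \<Rightarrow> 'b) \<Rightarrow>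
     (nat \<Rightarrow> 'a) \<Rightarrow> ereal" where
  "objective m p f \<phi> L x =
     (\<Sum>i=1..m. f i (x i)) + ereal (\<Sum>k=1..p. \<phi> k (\<Sum>i=1..m. L k i (x i)))"

definition is_solution ::
    "nat \<Rightarrow> nat \<Rightarrow> (nat \<Rightarrow> 'a set) \<Rightarrow> (nat \<Rightarrow> 'a \<Rightarrow> ereal) \<Rightarrow> (nat \<Rightarrow> 'b::real_inner \<Rightarrow> real) \<Rightarrow>
     (nat \<Rightarrow> nat \<Rightarrow> 'a \<Rightarrow> 'b) \<Rightarrow> (nat \<Rightarrow> 'a) \<Rightarrow> bool" where
  "is_solution m p H f \<phi> L x \<longleftrightarrow>
     is_arg_min (objective m p f \<phi> L) (\<lambda>x. \<forall>i\<in>{1..m}. x i \<in> H i) x"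

end

theory Submission
  imports Defs
begin

text \<open>
  The problem lives on the direct sum of the spaces \<open>H i\<close>. There it reads: minimize \<open>F + \<Phi>\<close> with
  \<open>F\<close> separable and \<open>\<Phi>\<close> smooth, and its solutions are the zeros of \<open>A + B\<close>, where \<open>A\<close> is the
  product of the subdifferentials of the \<open>f i\<close> and \<open>B = \<nabla>\<Phi>\<close> (\<open>solution_iff_subgradients\<close>). By the
  theorem of Baillon and Haddad each \<open>\<nabla>\<phi> k\<close> is \<open>1 / \<tau> k\<close>-cocoercive; composing with the operators
  \<open>L k i\<close> and adding up makes \<open>B\<close> \<open>\<beta>\<close>-cocoercive with exactly the given constant \<open>\<beta>\<close>
  (\<open>partial_gradient_cocoercive\<close>). The resolvent of \<open>A\<close> acts componentwise by the proximity
  operators, so the algorithm is the relaxed forward-backward iteration for \<open>A + B\<close>, up to errors.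

  For summable errors (\<open>forward_backward_summable_errors\<close>), no step increases the distance to a
  zero \<open>z\<close> by more than the error, and the decrease of the error-free step controls \<open>\<parallel>B x - B z\<parallel>\<close>
  and the displacement of the forward-backward map. Hence \<open>B (x n)\<close> converges strongly to \<open>B z\<close>
  and the displacement tends to \<open>0\<close>. The graph of a maximally monotone operator is closed under
  weak convergence of points and strong convergence of values, so every weak cluster point of \<open>x\<close>
  is a zero. Distances to zeros converge, so by Opial's argument two cluster points must coincide.

  It remains to see that all the perturbations are summable errors (\<open>perturbed_forward_backward\<close>).
  Different relaxation parameters and approximate proximity operators produce errors that are
  controlled on bounded sets only, so boundedness of the iterates comes first. The approximate
  operators are themselves nonexpansive, and they map the forward steps from \<open>z\<close>, which stay in a
  fixed ball, close to \<open>z\<close>; this gives a recursion \<open>r (n + 1) \<le> (1 + \<mu> n) r n + s n\<close> for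
  \<open>r n = \<parallel>x n - z\<parallel>\<close> with \<open>\<mu>\<close> and \<open>s\<close> summable.

  Weak cluster points are limits along filters finer than \<open>sequentially\<close>; Tychonoff's theorem
  provides such filters (\<open>bounded_family_weak_cluster\<close>).
\<close>

section \<open>Subgradients and proximity operators\<close>

definition subgradients :: "'a::real_inner set \<Rightarrow> ('a \<Rightarrow> ereal) \<Rightarrow> 'a \<Rightarrow> 'a set" where
  "subgradients H f p = {v \<in> H. f p \<noteq> \<infinity> \<and> (\<forall>y\<in>H. f p + ereal (v \<bullet> (y - p)) \<le> f y)}"

lemma hilbert_subspaceD:
  assumes "hilbert_subspace H"
  shows "subspace H" "complete H" "0 \<in> H"
    "\<And>x y. x \<in> H \<Longrightarrow> y \<in> H \<Longrightarrow> x + y \<in> H"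
    "\<And>x y. x \<in> H \<Longrightarrow> y \<in> H \<Longrightarrow> x - y \<in> H"
    "\<And>x r. x \<in> H \<Longrightarrow> r *\<^sub>R x \<in> H"
    "\<And>x. x \<in> H \<Longrightarrow> - x \<in> H"
  using assms unfolding hilbert_subspace_def
  by (auto simp: subspace_0 subspace_add subspace_diff subspace_scale subspace_neg)

text \<open>
  The last step of the nonexpansiveness proofs below: firm nonexpansiveness in the form of the
  hypothesis, followed by the Cauchy-Schwarz inequality.
\<close>

lemma norm_le_if_power2_le_inner:
  fixes d e :: "'a::real_inner"
  assumes "(norm d)\<^sup>2 \<le> d \<bullet> e"
  shows "norm d \<le> norm e"
proof (cases "d = 0")
  case False
  have "norm d * norm d \<le> norm d * norm e"
    using assms norm_cauchy_schwarz[of d e] by (simp add: power2_eq_square)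
  then show ?thesis using False by (simp add: mult_left_le_imp_le)
qed simp

text \<open>
  The limit inferior runs over punctured neighbourhoods of \<open>p\<close>; the inequality holds at \<open>p\<close> as
  well, so full neighbourhoods may be used.
\<close>

lemma lsc_onD:
  assumes "lsc_on H f" "p \<in> H" "c < f p"
  obtains d where "d > 0" "\<forall>y\<in>H. dist y p < d \<longrightarrow> c < f y"
proof -
  have "f p \<le> Liminf (at p within H) f" using assms by (auto simp: lsc_on_def)
  then have "eventually (\<lambda>y. c < f y) (at p within H)"
    using assms(3) unfolding le_Liminf_iff by blast
  then obtain d where "d > 0" "\<And>y. y \<in> H \<Longrightarrow> y \<noteq> p \<Longrightarrow> dist y p < d \<Longrightarrow> c < f y"
    unfolding eventually_at by auto
  with assms(3) have "\<forall>y\<in>H. dist y p < d \<longrightarrow> c < f y" by metis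
  with \<open>d > 0\<close> that show thesis by blast
qed

lemma Gamma0D:
  assumes "f \<in> Gamma0 H"
  shows "\<And>x. x \<in> H \<Longrightarrow> f x \<noteq> -\<infinity>" "\<exists>x\<in>H. f x \<noteq> \<infinity>" "lsc_on H f" "ereal_convex_on H f"
  using assms by (auto simp: Gamma0_def)

lemma Gamma0_convexD:
  assumes "f \<in> Gamma0 H" "x \<in> H" "y \<in> H" "f x = ereal a" "f y = ereal b" "0 < t" "t < 1"
  shows "f (x + t *\<^sub>R (y - x)) \<le> ereal ((1 - t) * a + t * b)"
proof -
  have "f ((1 - t) *\<^sub>R x + t *\<^sub>R y) \<le> ereal (1 - t) * f x + ereal t * f y"
    using assms Gamma0D(4)[OF assms(1)] unfolding ereal_convex_on_def
    by (metis greaterThanLessThan_iff)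
  also have "(1 - t) *\<^sub>R x + t *\<^sub>R y = x + t *\<^sub>R (y - x)" by (simp add: algebra_simps)
  finally show ?thesis using assms by simp
qed

lemma Gamma0_scale:
  assumes "f \<in> Gamma0 H" "\<gamma> > 0"
  shows "(\<lambda>y. ereal \<gamma> * f y) \<in> Gamma0 H"
proof -
  have less: "c / ereal \<gamma> < z \<longleftrightarrow> c < ereal \<gamma> * z" for c z
    using \<open>\<gamma> > 0\<close> by (cases c; cases z) (auto simp: field_simps)
  have "lsc_on H (\<lambda>y. ereal \<gamma> * f y)"
    unfolding lsc_on_def le_Liminf_iff
  proof (intro ballI allI impI)
    fix x c assume "x \<in> H" "c < ereal \<gamma> * f x"
    then have "c / ereal \<gamma> < f x"
      by (simp only: less)
    moreover have "f x \<le> Liminf (at x within H) f"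
      using \<open>x \<in> H\<close> Gamma0D(3)[OF assms(1)] by (auto simp: lsc_on_def)
    ultimately have "eventually (\<lambda>y. c / ereal \<gamma> < f y) (at x within H)"
      unfolding le_Liminf_iff by blast
    then show "eventually (\<lambda>y. c < ereal \<gamma> * f y) (at x within H)"
      by (simp only: less)
  qed
  moreover have "ereal_convex_on H (\<lambda>y. ereal \<gamma> * f y)"
    unfolding ereal_convex_on_def
  proof (intro ballI)
    fix x y and t :: real assume *: "x \<in> H" "y \<in> H" "t \<in> {0<..<1}"
    have "ereal \<gamma> * f ((1 - t) *\<^sub>R x + t *\<^sub>R y) \<le> ereal \<gamma> * (ereal (1 - t) * f x + ereal t * f y)"
      using * Gamma0D(4)[OF assms(1)] \<open>\<gamma> > 0\<close>
      by (intro ereal_mult_left_mono) (auto simp: ereal_convex_on_def)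
    also have "\<dots> = ereal (1 - t) * (ereal \<gamma> * f x) + ereal t * (ereal \<gamma> * f y)"
      using Gamma0D(1)[OF assms(1)] * \<open>\<gamma> > 0\<close>
      by (cases "f x"; cases "f y") (auto simp: algebra_simps)
    finally show "ereal \<gamma> * f ((1 - t) *\<^sub>R x + t *\<^sub>R y)
        \<le> ereal (1 - t) * (ereal \<gamma> * f x) + ereal t * (ereal \<gamma> * f y)" .
  qed
  moreover have "\<forall>x\<in>H. ereal \<gamma> * f x \<noteq> -\<infinity>"
    using Gamma0D(1)[OF assms(1)] \<open>\<gamma> > 0\<close> by auto
  moreover have "\<exists>x\<in>H. ereal \<gamma> * f x \<noteq> \<infinity>"
    using Gamma0D(2)[OF assms(1)] \<open>\<gamma> > 0\<close> by auto
  ultimately show ?thesis by (auto simp: Gamma0_def)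
qed

text \<open>
  Lower semicontinuity bounds \<open>f\<close> below by \<open>f x0 - 1\<close> on a ball around a point \<open>x0\<close> of its domain.
  Convexity on the segment from \<open>x0\<close> to a far point \<open>y\<close>, evaluated where the segment crosses half
  the radius, transports this to a bound that decreases linearly in the distance.
\<close>

lemma Gamma0_minorant:
  assumes H: "hilbert_subspace H" and f: "f \<in> Gamma0 H"
  obtains x0 K a where "x0 \<in> H" "K \<ge> 0" "\<forall>y\<in>H. ereal (a - K * norm (y - x0)) \<le> f y"
proof -
  note H = hilbert_subspaceD[OF H]
  obtain x0 where x0: "x0 \<in> H" "f x0 \<noteq> \<infinity>" using Gamma0D(2)[OF f] by blast
  then obtain A where A: "f x0 = ereal A" using Gamma0D(1)[OF f] by (cases "f x0") auto
  have "ereal (A - 1) < f x0" using A by simp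
  then obtain d where d: "d > 0" "\<And>y. y \<in> H \<Longrightarrow> dist y x0 < d \<Longrightarrow> ereal (A - 1) < f y"
    using lsc_onD[OF Gamma0D(3)[OF f] x0(1)] by metis
  have bound: "ereal (A - 1 - (2 / d) * norm (y - x0)) \<le> f y" if y: "y \<in> H" for y
  proof (cases "dist y x0 < d")
    case True
    then have "ereal (A - 1) \<le> f y" using d(2)[OF y] by simp
    moreover have "ereal (A - 1 - (2 / d) * norm (y - x0)) \<le> ereal (A - 1)" using d(1) by simp
    ultimately show ?thesis by (rule order_trans[rotated])
  next
    case far: False
    then have n: "norm (y - x0) \<ge> d" by (simp add: dist_norm)
    show ?thesis
    proof (cases "f y")
      case (real b)
      \<comment> \<open>chosen so that the point at parameter \<open>t\<close> has distance \<open>d / 2\<close> from \<open>x0\<close>\<close>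
      define t where "t = d / (2 * norm (y - x0))"
      have n0: "norm (y - x0) > 0" using n d(1) by linarith
      have t: "0 < t" "t < 1" using n n0 d(1) by (auto simp: t_def field_simps)
      have "x0 + t *\<^sub>R (y - x0) \<in> H" using H x0 y by blast
      moreover have "dist (x0 + t *\<^sub>R (y - x0)) x0 < d"
        using t n0 d(1) by (simp add: dist_norm t_def)
      ultimately have "ereal (A - 1) < f (x0 + t *\<^sub>R (y - x0))" using d(2) by blast
      also have "\<dots> \<le> ereal ((1 - t) * A + t * b)"
        by (rule Gamma0_convexD[OF f x0(1) y A real t])
      finally have "t * (A - b) < 1" by (simp add: algebra_simps)
      then have "A - b < 1 / t" using t by (simp add: field_simps)
      also have "1 / t = (2 / d) * norm (y - x0)" using d n0 by (simp add: t_def field_simps)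
      finally show ?thesis using real by simp
    qed (use Gamma0D(1)[OF f y] in auto)
  qed
  have "2 / d \<ge> 0" using d by simp
  with x0(1) bound that show thesis by blast
qed

text \<open>
  The objective \<open>g\<close> of the proximal problem is bounded below, because its quadratic term dominates
  the linear minorant. It is also strongly convex, so the midpoint inequality makes minimizing
  sequences Cauchy, and lower semicontinuity makes their limit \<open>p\<close> a minimizer. Comparing \<open>p\<close> with
  \<open>p + t *\<^sub>R (y - p)\<close> for \<open>t\<close> tending to \<open>0\<close> gives the subgradient inequality, which in turn
  forces \<open>g p < g y\<close> for every other \<open>y\<close>; so \<open>p\<close> is the point that the definite description
  selects.
\<close>

lemma prox_is_subgradient:
  assumes H: "hilbert_subspace H" and f: "f \<in> Gamma0 H" and x: "x \<in> H"
  shows "prox H f x \<in> H" "x - prox H f x \<in> subgradients H f (prox H f x)"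
proof -
  note HD = hilbert_subspaceD[OF H]
  define D where "D = {y \<in> H. f y \<noteq> \<infinity>}"
  define F where "F y = real_of_ereal (f y)" for y
  define g where "g y = F y + (norm (x - y))\<^sup>2 / 2" for y
  have fF: "f y = ereal (F y)" if "y \<in> D" for y
    using that Gamma0D(1)[OF f, of y] by (cases "f y") (auto simp: D_def F_def)
  have D_ne: "D \<noteq> {}" using Gamma0D(2)[OF f] by (auto simp: D_def)
  have DH: "y \<in> H" if "y \<in> D" for y using that by (auto simp: D_def)
  have conv: "x' + t *\<^sub>R (y' - x') \<in> D" "F (x' + t *\<^sub>R (y' - x')) \<le> (1 - t) * F x' + t * F y'"
    if "x' \<in> D" "y' \<in> D" "0 < t" "t < 1" for x' y' t
  proof -
    have *: "f (x' + t *\<^sub>R (y' - x')) \<le> ereal ((1 - t) * F x' + t * F y')"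
      using that DH fF by (intro Gamma0_convexD[OF f]) auto
    have "x' + t *\<^sub>R (y' - x') \<in> H" using that by (intro HD(4-6) DH)
    moreover have "f (x' + t *\<^sub>R (y' - x')) \<noteq> \<infinity>" using * by auto
    ultimately show d: "x' + t *\<^sub>R (y' - x') \<in> D" by (simp add: D_def)
    show "F (x' + t *\<^sub>R (y' - x')) \<le> (1 - t) * F x' + t * F y'"
      using * fF[OF d] by simp
  qed
  have strong: "g (u + (1/2) *\<^sub>R (v - u)) \<le> (g u + g v) / 2 - (norm (u - v))\<^sup>2 / 8"
    "u + (1/2) *\<^sub>R (v - u) \<in> D"
    if "u \<in> D" "v \<in> D" for u v
  proof -
    let ?w = "u + (1/2) *\<^sub>R (v - u)"
    show "?w \<in> D" using conv(1)[OF that, of "1/2"] by simp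
    have F: "F ?w \<le> (F u + F v) / 2" using conv(2)[OF that, of "1/2"] by simp
    have "x - ?w = (1/2) *\<^sub>R ((x - u) + (x - v))" by (simp add: algebra_simps flip: scaleR_add_left)
    then have "(norm (x - ?w))\<^sup>2 = (norm ((x - u) + (x - v)))\<^sup>2 / 4"
      by (simp only: norm_scaleR power_mult_distrib) (simp add: power2_eq_square)
    moreover have "(norm ((x - u) + (x - v)))\<^sup>2 + (norm (u - v))\<^sup>2
        = 2 * (norm (x - u))\<^sup>2 + 2 * (norm (x - v))\<^sup>2"
      unfolding power2_norm_eq_inner by (simp add: inner_simps inner_commute)
    ultimately have "(norm (x - ?w))\<^sup>2
        = (norm (x - u))\<^sup>2 / 2 + (norm (x - v))\<^sup>2 / 2 - (norm (u - v))\<^sup>2 / 4" by simp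
    then show "g ?w \<le> (g u + g v) / 2 - (norm (u - v))\<^sup>2 / 8" using F by (simp add: g_def field_simps)
  qed
  obtain x0 K a where minorant: "x0 \<in> H" "K \<ge> 0" "\<forall>y\<in>H. ereal (a - K * norm (y - x0)) \<le> f y"
    by (rule Gamma0_minorant[OF H f])
  \<comment> \<open>the slope \<open>K\<close> is absorbed by the quadratic term: \<open>K * s \<le> K\<^sup>2 / 2 + s\<^sup>2 / 2\<close>\<close>
  define c where "c = a - K * norm (x - x0) - K\<^sup>2 / 2"
  have lower: "c \<le> g y" if "y \<in> D" for y
  proof -
    have "a - K * norm (y - x0) \<le> F y" using minorant(3) DH[OF that] fF[OF that]
      by (metis ereal_less_eq(3))
    moreover have "norm (y - x0) \<le> norm (x - y) + norm (x - x0)"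
      using norm_triangle_ineq[of "y - x" "x - x0"] by (simp add: norm_minus_commute)
    then have "K * norm (y - x0) \<le> K * norm (x - y) + K * norm (x - x0)"
      using minorant(2) by (metis distrib_left mult_left_mono)
    moreover have "0 \<le> (norm (x - y) - K)\<^sup>2" by simp
    then have "K * norm (x - y) \<le> K\<^sup>2 / 2 + (norm (x - y))\<^sup>2 / 2"
      by (simp add: power2_eq_square algebra_simps)
    ultimately show ?thesis by (simp add: g_def c_def)
  qed
  define M where "M = Inf (g ` D)"
  have bdd: "bdd_below (g ` D)" using lower by (auto intro!: bdd_belowI)
  have M: "M \<le> g y" if "y \<in> D" for y using that bdd by (auto simp: M_def intro!: cInf_lower)
  have "\<exists>y\<in>D. g y < M + 1 / Suc n" for n
  proof -
    have "\<exists>s\<in>g ` D. s < M + 1 / Suc n"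
      unfolding M_def using D_ne by (intro cInf_lessD) auto
    then show ?thesis by auto
  qed
  then obtain Y where YD: "\<And>n. Y n \<in> D" and Y: "\<And>n. g (Y n) < M + 1 / Suc n" by metis
  have close: "(norm (Y n - Y k))\<^sup>2 \<le> 8 / Suc N" if "n \<ge> N" "k \<ge> N" for n k N
  proof -
    define s where "s j = 1 / real (Suc j)" for j
    have "M \<le> (g (Y n) + g (Y k)) / 2 - (norm (Y n - Y k))\<^sup>2 / 8"
      using strong[OF YD YD] M order_trans by meson
    moreover have "s n \<le> s N" "s k \<le> s N"
      using that by (auto simp: s_def intro!: divide_left_mono)
    moreover have "g (Y n) < M + s n" "g (Y k) < M + s k" using Y by (simp_all add: s_def)
    ultimately have "(norm (Y n - Y k))\<^sup>2 \<le> 8 * s N" by argo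
    then show ?thesis by (simp add: s_def)
  qed
  have "Cauchy Y"
    unfolding Cauchy_def
  proof (intro allI impI)
    fix e :: real assume e: "e > 0"
    obtain N :: nat where N: "8 / e\<^sup>2 < N" using reals_Archimedean2 by blast
    then have "8 / e\<^sup>2 < Suc N" by simp
    then have "8 / Suc N < e\<^sup>2" using e by (simp add: field_simps)
    then have "norm (Y n - Y k) < e" if "n \<ge> N" "k \<ge> N" for n k
      using close[OF that] e by (smt (verit) power_mono)
    then show "\<exists>N. \<forall>m\<ge>N. \<forall>n\<ge>N. dist (Y m) (Y n) < e" by (auto simp: dist_norm)
  qed
  then obtain p where p: "p \<in> H" "Y \<longlonglongrightarrow> p"
    using HD(2) YD DH unfolding complete_def by metis
  have nlim: "(\<lambda>n. M + 1 / Suc n - (norm (x - Y n))\<^sup>2 / 2) \<longlonglongrightarrow> M + 0 - (norm (x - p))\<^sup>2 / 2"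
    by (intro tendsto_intros p LIMSEQ_inverse_real_of_nat[unfolded inverse_eq_divide]) simp
  have fp: "f p \<le> ereal (M - (norm (x - p))\<^sup>2 / 2)"
  proof (rule ccontr)
    assume "\<not> ?thesis"
    then have "ereal (M - (norm (x - p))\<^sup>2 / 2) < f p" by simp
    then obtain c' where c': "M - (norm (x - p))\<^sup>2 / 2 < c'" "ereal c' < f p"
      using ereal_dense2 by (metis ereal_less_eq(3) less_ereal.simps(1))
    obtain d where d: "d > 0" "\<And>y. y \<in> H \<Longrightarrow> dist y p < d \<Longrightarrow> ereal c' < f y"
      using lsc_onD[OF Gamma0D(3)[OF f] p(1) c'(2)] by metis
    have "eventually (\<lambda>n. dist (Y n) p < d) sequentially" using p(2) d(1) by (rule tendstoD)
    then have "eventually (\<lambda>n. c' \<le> M + 1 / Suc n - (norm (x - Y n))\<^sup>2 / 2) sequentially"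
    proof eventually_elim
      case (elim n)
      then have "c' < F (Y n)" using d(2)[OF DH[OF YD]] fF[OF YD] by fastforce
      then show ?case using Y[of n] by (simp add: g_def)
    qed
    then have "c' \<le> M + 0 - (norm (x - p))\<^sup>2 / 2"
      using tendsto_lowerbound[OF nlim] by simp
    then show False using c' by simp
  qed
  then have pD: "p \<in> D" using p by (auto simp: D_def)
  have gp: "g p \<le> g y" if "y \<in> D" for y
    using fp fF[OF pD] M[OF that] by (simp add: g_def)
  have ineq: "F p + (x - p) \<bullet> (y - p) \<le> F y" if y: "y \<in> D" for y
  proof -
    have step: "(x - p) \<bullet> (y - p) + F p - F y \<le> t * ((norm (y - p))\<^sup>2 / 2)" if t: "0 < t" "t < 1" for t
    proof -
      have "g p \<le> g (p + t *\<^sub>R (y - p))" using gp conv(1)[OF pD y t] by blast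
      also have "(norm (x - (p + t *\<^sub>R (y - p))))\<^sup>2
          = (norm (x - p))\<^sup>2 - 2 * t * ((x - p) \<bullet> (y - p)) + t\<^sup>2 * (norm (y - p))\<^sup>2"
        unfolding power2_norm_eq_inner
        by (simp add: inner_simps inner_commute algebra_simps power2_eq_square)
      then have "g (p + t *\<^sub>R (y - p)) \<le> (1 - t) * F p + t * F y + ((norm (x - p))\<^sup>2
          - 2 * t * ((x - p) \<bullet> (y - p)) + t\<^sup>2 * (norm (y - p))\<^sup>2) / 2"
        using conv(2)[OF pD y t] by (simp add: g_def)
      finally have "t * ((x - p) \<bullet> (y - p) + F p - F y) \<le> t * (t * ((norm (y - p))\<^sup>2 / 2))"
        by (simp add: g_def algebra_simps power2_eq_square add_divide_distrib diff_divide_distrib)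
      then show ?thesis using t by (simp add: mult_le_cancel_left_pos)
    qed
    have "((\<lambda>t. t * ((norm (y - p))\<^sup>2 / 2)) \<longlongrightarrow> 0 * ((norm (y - p))\<^sup>2 / 2)) (at_right 0)"
      by (intro tendsto_intros)
    moreover have "eventually (\<lambda>t. (x - p) \<bullet> (y - p) + F p - F y \<le> t * ((norm (y - p))\<^sup>2 / 2)) (at_right 0)"
      using step by (auto intro!: eventually_at_rightI[of 0 1])
    ultimately have "(x - p) \<bullet> (y - p) + F p - F y \<le> 0 * ((norm (y - p))\<^sup>2 / 2)"
      by (intro tendsto_lowerbound) auto
    then show ?thesis by simp
  qed
  have strict: "g p < g y" if "y \<in> D" "y \<noteq> p" for y
  proof -
    have "(norm (x - y))\<^sup>2 = (norm (x - p))\<^sup>2 - 2 * ((x - p) \<bullet> (y - p)) + (norm (y - p))\<^sup>2"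
      unfolding power2_norm_eq_inner by (simp add: inner_simps inner_commute)
    moreover have "(norm (y - p))\<^sup>2 > 0" using that by simp
    ultimately show ?thesis using ineq[OF that(1)] unfolding g_def by argo
  qed
  let ?obj = "\<lambda>y. f y + ereal ((norm (x - y))\<^sup>2 / 2)"
  have obj: "?obj y = (if y \<in> D then ereal (g y) else \<infinity>)" if "y \<in> H" for y
    using that fF[of y] by (cases "y \<in> D") (auto simp: g_def D_def)
  have "is_arg_min ?obj (\<lambda>y. y \<in> H) y \<longleftrightarrow> y = p" for y
  proof
    assume y: "is_arg_min ?obj (\<lambda>y. y \<in> H) y"
    then have "y \<in> H" "\<not> ?obj p < ?obj y" using p by (auto simp: is_arg_min_def)
    then show "y = p" using strict[of y] obj[of y] obj[of p] p pD by (auto split: if_splits)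
  next
    assume "y = p"
    then show "is_arg_min ?obj (\<lambda>y. y \<in> H) y"
      unfolding is_arg_min_def using obj gp p pD by (auto simp: not_less)
  qed
  then have "prox H f x = p" unfolding prox_def by (intro the_equality) blast+
  moreover have "x - p \<in> subgradients H f p"
  proof -
    have "f p + ereal ((x - p) \<bullet> (y - p)) \<le> f y" if "y \<in> H" for y
      using ineq[of y] fF[of y] fF[OF pD] that by (cases "y \<in> D") (auto simp: D_def)
    then show ?thesis using pD p HD x by (auto simp: subgradients_def D_def)
  qed
  ultimately show "prox H f x \<in> H" "x - prox H f x \<in> subgradients H f (prox H f x)"
    using p by auto
qed

lemma subgradients_monotone:
  assumes f: "f \<in> Gamma0 H" and "p \<in> H" "q \<in> H" "u \<in> subgradients H f p" "v \<in> subgradients H f q"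
  shows "0 \<le> (p - q) \<bullet> (u - v)"
proof -
  obtain a b where ab: "f p = ereal a" "f q = ereal b"
    using assms Gamma0D(1)[OF f, of p] Gamma0D(1)[OF f, of q]
    by (cases "f p"; cases "f q") (auto simp: subgradients_def)
  have "f p + ereal (u \<bullet> (q - p)) \<le> f q" "f q + ereal (v \<bullet> (p - q)) \<le> f p"
    using assms by (auto simp: subgradients_def)
  then show ?thesis using ab by (simp add: inner_simps inner_commute)
qed

lemma subgradients_scaleD:
  assumes f: "f \<in> Gamma0 H" and H: "hilbert_subspace H" and "\<gamma> > 0" "p \<in> H"
    and v: "v \<in> subgradients H (\<lambda>y. ereal \<gamma> * f y) p"
  shows "(1 / \<gamma>) *\<^sub>R v \<in> subgradients H f p"
proof -
  have "f p \<noteq> \<infinity>" using v \<open>\<gamma> > 0\<close> by (auto simp: subgradients_def)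
  then obtain a where a: "f p = ereal a" using Gamma0D(1)[OF f \<open>p \<in> H\<close>] by (cases "f p") auto
  have "f p + ereal ((1 / \<gamma>) *\<^sub>R v \<bullet> (y - p)) \<le> f y" if "y \<in> H" for y
  proof (cases "f y")
    case (real b)
    then show ?thesis using v that a \<open>\<gamma> > 0\<close> by (force simp: subgradients_def field_simps)
  qed (use Gamma0D(1)[OF f that] in auto)
  then show ?thesis using v a hilbert_subspaceD[OF H] by (auto simp: subgradients_def)
qed

lemma prox_nonexpansive:
  assumes H: "hilbert_subspace H" and f: "f \<in> Gamma0 H" and u: "u \<in> H" "v \<in> H"
  shows "norm (prox H f u - prox H f v) \<le> norm (u - v)"
proof -
  let ?p = "prox H f u" and ?q = "prox H f v"
  have "0 \<le> (?p - ?q) \<bullet> ((u - ?p) - (v - ?q))"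
    by (intro subgradients_monotone[OF f] prox_is_subgradient[OF H f] u)
  also have "(u - ?p) - (v - ?q) = (u - v) - (?p - ?q)" by simp
  finally have "(norm (?p - ?q))\<^sup>2 \<le> (?p - ?q) \<bullet> (u - v)"
    by (simp only: inner_diff_right[of _ "u - v"] power2_norm_eq_inner)
  then show ?thesis by (rule norm_le_if_power2_le_inner)
qed

text \<open>
  For a step size \<open>\<gamma>\<close> the proximity operator of \<open>\<gamma> f\<close> is the resolvent of \<open>\<gamma>\<close> times the
  subdifferential of \<open>f\<close>.
\<close>

lemma prox_scaled:
  assumes "hilbert_subspace H" "f \<in> Gamma0 H" "\<gamma> > 0" "x \<in> H"
  defines "p \<equiv> prox H (\<lambda>y. ereal \<gamma> * f y) x"
  shows "p \<in> H" "(1 / \<gamma>) *\<^sub>R (x - p) \<in> subgradients H f p"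
proof -
  note pr = prox_is_subgradient[OF assms(1) Gamma0_scale[OF assms(2,3)] assms(4), folded p_def]
  show "p \<in> H" by (rule pr(1))
  show "(1 / \<gamma>) *\<^sub>R (x - p) \<in> subgradients H f p"
    by (rule subgradients_scaleD[OF assms(2,1,3) pr])
qed

section \<open>Riesz representation and weak cluster points\<close>

text \<open>
  The representing vector is the proximal point of \<open>- D\<close> at the origin: its subgradient inequality
  says \<open>D u \<le> p \<bullet> u\<close> for all \<open>u\<close>, and replacing \<open>u\<close> by \<open>- u\<close> turns this into an equality.
\<close>

lemma riesz_representation_on:
  assumes H: "hilbert_subspace H"
    and add: "\<And>u v. u \<in> H \<Longrightarrow> v \<in> H \<Longrightarrow> D (u + v) = D u + D v"
    and scale: "\<And>r u. u \<in> H \<Longrightarrow> D (r *\<^sub>R u) = r * D u"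
    and bound: "\<And>u. u \<in> H \<Longrightarrow> \<bar>D u\<bar> \<le> K * norm u"
  obtains w where "w \<in> H" "\<forall>u\<in>H. D u = w \<bullet> u"
proof -
  note HD = hilbert_subspaceD[OF H]
  define f where "f u = ereal (- D u)" for u
  have diff: "D (u - v) = D u - D v" if "u \<in> H" "v \<in> H" for u v
    using add[OF that(1) HD(7)[OF that(2)]] scale[OF that(2), of "-1"] by simp
  have lsc: "lsc_on H f"
    unfolding lsc_on_def le_Liminf_iff
  proof (intro ballI allI impI)
    fix u c assume u: "u \<in> H" and c: "c < f u"
    have "((\<lambda>v. D v - D u) \<longlongrightarrow> 0) (at u within H)"
    proof (rule Lim_null_comparison)
      show "eventually (\<lambda>v. norm (D v - D u) \<le> K * norm (v - u)) (at u within H)"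
        unfolding eventually_at_filter
        by (rule always_eventually) (metis bound diff u HD(5) real_norm_def)
      show "((\<lambda>v. K * norm (v - u)) \<longlongrightarrow> 0) (at u within H)"
        by (auto intro!: tendsto_eq_intros)
    qed
    then have "(D \<longlongrightarrow> D u) (at u within H)" by (rule iffD2[OF Lim_null])
    then have "(f \<longlongrightarrow> f u) (at u within H)" unfolding f_def lim_ereal by (rule tendsto_minus)
    then show "eventually (\<lambda>v. c < f v) (at u within H)" using c by (rule order_tendstoD)
  qed
  have "ereal_convex_on H f"
    unfolding ereal_convex_on_def f_def using HD by (simp add: add scale)
  then have "f \<in> Gamma0 H" using lsc HD(3) by (auto simp: Gamma0_def f_def)
  from prox_is_subgradient[OF H this HD(3)] obtain p where
    p: "p \<in> H" "- p \<in> subgradients H f p" by auto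
  have le: "D u \<le> p \<bullet> u" if u: "u \<in> H" for u
  proof -
    have "f p + ereal (- p \<bullet> (p + u - p)) \<le> f (p + u)"
      using p(2) HD(4)[OF p(1) u] by (auto simp: subgradients_def)
    then show ?thesis using add[OF p(1) u] by (simp add: f_def)
  qed
  have "D u = p \<bullet> u" if "u \<in> H" for u
    using le[OF that] le[OF HD(7)[OF that]] scale[OF that, of "-1"] by simp
  with p(1) that show thesis by blast
qed

text \<open>
  Each \<open>x i\<close>, seen as the functional \<open>u \<mapsto> x i \<bullet> u\<close>, is a point of the product of the intervals
  \<open>[- M * norm u, M * norm u]\<close>, which is compact by Tychonoff's theorem. The image of \<open>F\<close> has a
  cluster point \<open>D\<close> there; refining \<open>F\<close> by the neighbourhoods of \<open>D\<close> turns clustering into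
  pointwise convergence, so \<open>D\<close> inherits linearity and the norm bound and is represented by a
  vector \<open>w\<close>.
\<close>

lemma bounded_family_weak_cluster:
  fixes x :: "'i \<Rightarrow> 'a::real_inner"
  assumes H: "hilbert_subspace H" and F: "F \<noteq> bot"
    and x: "\<And>i. x i \<in> H" and M: "\<And>i. norm (x i) \<le> M"
  obtains F' w where "F' \<le> F" "F' \<noteq> bot" "w \<in> H" "\<forall>u\<in>H. ((\<lambda>i. x i \<bullet> u) \<longlongrightarrow> w \<bullet> u) F'"
proof -
  define g where "g i u = x i \<bullet> u" for i u
  define C where "C = PiE UNIV (\<lambda>u::'a. {- (M * norm u) .. M * norm u})"
  have "compact C"
    unfolding C_def compactin_euclidean_iff[symmetric] euclidean_product_topology[symmetric]
      compactin_PiE by auto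
  moreover have gC: "g i \<in> C" for i
  proof -
    have "\<bar>x i \<bullet> u\<bar> \<le> M * norm u" for u
      using Cauchy_Schwarz_ineq2[of "x i" u] M[of i] by (meson mult_right_mono norm_ge_zero order_trans)
    then show ?thesis by (auto simp: C_def g_def abs_le_iff minus_le_iff)
  qed
  moreover have "filtermap g F \<noteq> bot" using F by (simp add: filtermap_bot_iff)
  ultimately obtain D where D: "D \<in> C" "inf (nhds D) (filtermap g F) \<noteq> bot"
    unfolding compact_filter by (metis (mono_tags, lifting) always_eventually eventually_filtermap)
  define F' where "F' = inf F (filtercomap g (nhds D))"
  have "F' \<noteq> bot"
  proof
    assume "F' = bot"
    then have "eventually (\<lambda>_. False) F'" by simp
    then obtain P Q where PQ: "eventually P F" "eventually Q (nhds D)" "\<And>i. P i \<Longrightarrow> Q (g i) \<Longrightarrow> False"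
      unfolding F'_def eventually_inf eventually_filtercomap by metis
    from PQ(1) have "eventually (\<lambda>i. \<not> Q (g i)) F"
      by (rule eventually_mono) (use PQ(3) in blast)
    then have "eventually (\<lambda>h. \<not> Q h) (filtermap g F)" by (simp add: eventually_filtermap)
    with PQ(2) have "eventually (\<lambda>_. False) (inf (nhds D) (filtermap g F))"
      unfolding eventually_inf by blast
    then show False using D(2) by (simp add: trivial_limit_def)
  qed
  have "filterlim g (nhds D) F'"
    unfolding F'_def filterlim_def filtermap_le_iff_le_filtercomap by simp
  then have lim: "((\<lambda>i. x i \<bullet> u) \<longlongrightarrow> D u) F'" for u
    using continuous_on_tendsto_compose[OF continuous_on_product_coordinates[of u]]
    by (fastforce simp: g_def)
  have "D (u + v) = D u + D v" for u v
    using tendsto_unique[OF \<open>F' \<noteq> bot\<close> lim] tendsto_add[OF lim lim] by (simp add: inner_simps)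
  moreover have "D (r *\<^sub>R u) = r * D u" for r u
    using tendsto_unique[OF \<open>F' \<noteq> bot\<close> lim] tendsto_mult_left[OF lim] by (simp add: inner_simps)
  moreover have "\<bar>D u\<bar> \<le> M * norm u" for u
  proof -
    have "D u \<in> {- (M * norm u) .. M * norm u}" using D(1) unfolding C_def by (rule PiE_mem) simp
    then show ?thesis by (simp add: abs_le_iff)
  qed
  ultimately obtain w where "w \<in> H" "\<forall>u\<in>H. D u = w \<bullet> u"
    by (rule riesz_representation_on[OF H])
  then have "\<forall>u\<in>H. ((\<lambda>i. x i \<bullet> u) \<longlongrightarrow> w \<bullet> u) F'" using lim by metis
  with \<open>w \<in> H\<close> \<open>F' \<noteq> bot\<close> show thesis using that[of F' w] by (simp add: F'_def)
qed

lemma inner_tendsto_weak_strong: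
  fixes X V :: "'i \<Rightarrow> 'a::real_inner"
  assumes weak: "\<forall>u\<in>H. ((\<lambda>i. X i \<bullet> u) \<longlongrightarrow> w \<bullet> u) F" and bdd: "\<And>i. norm (X i) \<le> M"
    and strong: "(V \<longlongrightarrow> v) F" and v: "v \<in> H"
  shows "((\<lambda>i. X i \<bullet> V i) \<longlongrightarrow> w \<bullet> v) F"
proof -
  have "((\<lambda>i. X i \<bullet> (V i - v)) \<longlongrightarrow> 0) F"
  proof (rule Lim_null_comparison)
    show "eventually (\<lambda>i. norm (X i \<bullet> (V i - v)) \<le> M * norm (V i - v)) F"
    proof (rule always_eventually, rule allI)
      fix i
      show "norm (X i \<bullet> (V i - v)) \<le> M * norm (V i - v)"
        using Cauchy_Schwarz_ineq2[of "X i" "V i - v"] mult_right_mono[OF bdd[of i] norm_ge_zero]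
        by (metis order_trans real_norm_def)
    qed
    have "((\<lambda>i. M * norm (V i - v)) \<longlongrightarrow> M * norm (v - v)) F" by (intro tendsto_intros strong)
    then show "((\<lambda>i. M * norm (V i - v)) \<longlongrightarrow> 0) F" by simp
  qed
  from tendsto_add[OF this weak[rule_format, OF v]] show ?thesis by (simp add: inner_simps)
qed

section \<open>Quasi-Fejer monotone real sequences\<close>

text \<open>
  A discrete Gronwall inequality: the factors \<open>1 + \<mu> k\<close> multiply up to at most \<open>exp (suminf \<mu>)\<close>.
\<close>

lemma quasi_fejer_bounded:
  fixes r \<mu> s :: "nat \<Rightarrow> real"
  assumes step: "\<And>n. r (Suc n) \<le> (1 + \<mu> n) * r n + s n"
    and nonneg: "\<And>n. 0 \<le> r n" "\<And>n. 0 \<le> \<mu> n" "\<And>n. 0 \<le> s n"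
    and summable: "summable \<mu>" "summable s"
  obtains C where "\<forall>n. r n \<le> C"
proof -
  have "r n \<le> exp (sum \<mu> {..<n}) * (r 0 + sum s {..<n})" for n
  proof (induction n)
    case (Suc n)
    let ?E = "exp (sum \<mu> {..<n})" and ?E' = "exp (sum \<mu> {..<Suc n})"
    have "1 + \<mu> n \<le> exp (\<mu> n)" by (rule exp_ge_add_one_self)
    then have E: "(1 + \<mu> n) * ?E \<le> ?E'" by (simp add: exp_add mult.commute)
    have "r (Suc n) \<le> (1 + \<mu> n) * (?E * (r 0 + sum s {..<n})) + s n"
      using step[of n] mult_left_mono[OF Suc, of "1 + \<mu> n"] nonneg(2)[of n] by linarith
    also have "\<dots> = ((1 + \<mu> n) * ?E) * (r 0 + sum s {..<n}) + s n" by simp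
    also have "\<dots> \<le> ?E' * (r 0 + sum s {..<n}) + ?E' * s n"
    proof (rule add_mono)
      show "((1 + \<mu> n) * ?E) * (r 0 + sum s {..<n}) \<le> ?E' * (r 0 + sum s {..<n})"
        using E nonneg by (intro mult_right_mono add_nonneg_nonneg sum_nonneg)
      have "1 \<le> ?E'" using nonneg(2) by (simp add: sum_nonneg del: sum.lessThan_Suc)
      then show "s n \<le> ?E' * s n" using nonneg(3)[of n] by (simp add: mult_le_cancel_right1)
    qed
    finally show ?case by (simp add: algebra_simps)
  qed simp
  also have "exp (sum \<mu> {..<n}) * (r 0 + sum s {..<n}) \<le> exp (suminf \<mu>) * (r 0 + suminf s)" for n
    using nonneg summable by (intro mult_mono add_mono) (auto intro!: sum_le_suminf sum_nonneg add_nonneg_nonneg)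
  finally show thesis using that by blast
qed

text \<open>
  Subtracting the partial sums of \<open>s\<close> makes the sequence decreasing.
\<close>

lemma quasi_fejer_convergent:
  fixes r s :: "nat \<Rightarrow> real"
  assumes step: "\<And>n. r (Suc n) \<le> r n + s n"
    and nonneg: "\<And>n. 0 \<le> r n" "\<And>n. 0 \<le> s n" and summable: "summable s"
  shows "convergent r"
proof -
  define d where "d n = r n - sum s {..<n}" for n
  have "decseq d" using step by (auto simp: decseq_Suc_iff d_def algebra_simps)
  moreover have "- suminf s \<le> d n" for n
    using nonneg(1)[of n] sum_le_suminf[OF summable, of "{..<n}"] nonneg(2) by (simp add: d_def)
  ultimately have "convergent d" using decseq_convergent by (metis convergent_def)
  moreover have "convergent (\<lambda>n. sum s {..<n})"
    using summable summable_iff_convergent by blast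
  ultimately have "convergent (\<lambda>n. d n + sum s {..<n})" by (rule convergent_add)
  then show ?thesis by (simp add: d_def)
qed

section \<open>Forward-backward splitting for monotone inclusions\<close>

lemma power2_norm_diff_scaleR:
  fixes a b :: "'a::real_inner"
  shows "(norm (a - r *\<^sub>R b))\<^sup>2 = (norm a)\<^sup>2 - 2 * r * (a \<bullet> b) + r\<^sup>2 * (norm b)\<^sup>2"
  unfolding power2_norm_eq_inner
  by (simp add: inner_diff_left inner_diff_right inner_commute[of b a] power2_eq_square algebra_simps)

text \<open>
  Maximal monotonicity of the operator with graph \<open>A\<close> is stated by Minty's criterion, surjectivity
  of the identity plus the operator, since this is what the existence of proximal points provides.
  A zero of \<open>A + B\<close> is a point \<open>z\<close> with \<open>(z, - B z) \<in> A\<close>.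
\<close>

locale monotone_inclusion =
  fixes H :: "'a::real_inner set" and A :: "('a \<times> 'a) set" and B :: "'a \<Rightarrow> 'a" and \<beta> :: real
  assumes hilbert: "hilbert_subspace H"
    and graph: "A \<subseteq> H \<times> H"
    and monotone: "(p, u) \<in> A \<Longrightarrow> (q, v) \<in> A \<Longrightarrow> 0 \<le> (p - q) \<bullet> (u - v)"
    and minty: "u \<in> H \<Longrightarrow> \<exists>p. (p, u - p) \<in> A"
    and B_mem: "u \<in> H \<Longrightarrow> B u \<in> H"
    and cocoercive: "u \<in> H \<Longrightarrow> v \<in> H \<Longrightarrow> \<beta> * (norm (B u - B v))\<^sup>2 \<le> (u - v) \<bullet> (B u - B v)"
    and beta_pos: "0 < \<beta>"
begin

lemmas mem = hilbert_subspaceD(3-7)[OF hilbert]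

lemma graph_mem: "(p, u) \<in> A \<Longrightarrow> p \<in> H" "(p, u) \<in> A \<Longrightarrow> u \<in> H"
  using graph by auto

text \<open>
  Minty's argument: the resolvent \<open>p\<close> of \<open>w + v\<close> satisfies \<open>(w - p) \<bullet> (p - w) \<ge> 0\<close>, so \<open>p = w\<close>.
\<close>

lemma maximal:
  assumes w: "w \<in> H" "v \<in> H" and mono: "\<And>q r. (q, r) \<in> A \<Longrightarrow> 0 \<le> (w - q) \<bullet> (v - r)"
  shows "(w, v) \<in> A"
proof -
  obtain p where p: "(p, w + v - p) \<in> A" using minty[OF mem(2)[OF w]] by blast
  have "0 \<le> (w - p) \<bullet> (v - (w + v - p))" using mono[OF p] .
  also have "v - (w + v - p) = - (w - p)" by simp
  finally have "(norm (w - p))\<^sup>2 \<le> 0" 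
    by (simp only: power2_norm_eq_inner inner_minus_right)
  then have "w = p" by simp
  then show ?thesis using p by simp
qed

lemma resolvent_nonexpansive:
  assumes "0 < \<gamma>" "(p, (1 / \<gamma>) *\<^sub>R (u - p)) \<in> A" "(q, (1 / \<gamma>) *\<^sub>R (v - q)) \<in> A"
  shows "norm (p - q) \<le> norm (u - v)"
proof -
  have "0 \<le> (p - q) \<bullet> ((1 / \<gamma>) *\<^sub>R (u - p) - (1 / \<gamma>) *\<^sub>R (v - q))"
    by (rule monotone[OF assms(2,3)])
  also have "\<dots> = (1 / \<gamma>) * ((p - q) \<bullet> (u - v) - (norm (p - q))\<^sup>2)"
    by (simp add: power2_norm_eq_inner inner_simps algebra_simps diff_divide_distrib)
  finally have "(norm (p - q))\<^sup>2 \<le> (p - q) \<bullet> (u - v)"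
    using \<open>0 < \<gamma>\<close> by (simp add: zero_le_divide_iff)
  then show ?thesis by (rule norm_le_if_power2_le_inner)
qed

text \<open>
  Expanding the square leaves a cross term \<open>(u - v) \<bullet> (B u - B v)\<close>, which cocoercivity bounds
  below by \<open>\<beta> * (norm (B u - B v))\<^sup>2\<close>. Step sizes up to \<open>2 * \<beta>\<close> are therefore nonexpansive.
\<close>

lemma forward_step:
  assumes u: "u \<in> H" "v \<in> H" and \<gamma>: "0 \<le> \<gamma>"
  shows "(norm (u - v - \<gamma> *\<^sub>R (B u - B v)))\<^sup>2
    \<le> (norm (u - v))\<^sup>2 - \<gamma> * (2 * \<beta> - \<gamma>) * (norm (B u - B v))\<^sup>2"
proof -
  have "(norm (u - v - \<gamma> *\<^sub>R (B u - B v)))\<^sup>2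
      = (norm (u - v))\<^sup>2 - 2 * \<gamma> * ((u - v) \<bullet> (B u - B v)) + \<gamma>\<^sup>2 * (norm (B u - B v))\<^sup>2"
    by (rule power2_norm_diff_scaleR)
  moreover have "\<gamma> * (\<beta> * (norm (B u - B v))\<^sup>2) \<le> \<gamma> * ((u - v) \<bullet> (B u - B v))"
    using cocoercive[OF u] \<gamma> by (rule mult_left_mono)
  moreover have "\<gamma> * (2 * \<beta> - \<gamma>) * (norm (B u - B v))\<^sup>2
      = 2 * (\<gamma> * (\<beta> * (norm (B u - B v))\<^sup>2)) - \<gamma>\<^sup>2 * (norm (B u - B v))\<^sup>2"
    by (simp add: left_diff_distrib right_diff_distrib power2_eq_square)
  ultimately show ?thesis by linarith
qed

lemma forward_step_nonexpansive:
  assumes "u \<in> H" "v \<in> H" "0 \<le> \<gamma>" "\<gamma> \<le> 2 * \<beta>"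
  shows "norm (u - v - \<gamma> *\<^sub>R (B u - B v)) \<le> norm (u - v)"
proof -
  have "0 \<le> \<gamma> * (2 * \<beta> - \<gamma>) * (norm (B u - B v))\<^sup>2" using assms by simp
  then have "(norm (u - v - \<gamma> *\<^sub>R (B u - B v)))\<^sup>2 \<le> (norm (u - v))\<^sup>2"
    using forward_step[OF assms(1-3)] by linarith
  then show ?thesis by (rule power2_le_imp_le) simp
qed

text \<open>
  The contraction estimate behind the convergence proof. Monotonicity of \<open>A\<close> at \<open>y\<close> and \<open>w\<close> says
  that \<open>d = u - y - \<gamma> *\<^sub>R (B u - B w)\<close> makes an acute angle with \<open>y - w\<close>. Since \<open>d\<close> and \<open>y - w\<close>
  add up to the difference of the forward steps from \<open>u\<close> and \<open>w\<close>, its square is a gain.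
\<close>

lemma forward_backward_step:
  assumes w: "(w, - B w) \<in> A" and u: "u \<in> H" and y: "(y, (1 / \<gamma>) *\<^sub>R (u - \<gamma> *\<^sub>R B u - y)) \<in> A"
    and \<gamma>: "0 < \<gamma>"
  shows "(norm (y - w))\<^sup>2 \<le> (norm (u - w))\<^sup>2 - \<gamma> * (2 * \<beta> - \<gamma>) * (norm (B u - B w))\<^sup>2
    - (norm (u - y - \<gamma> *\<^sub>R (B u - B w)))\<^sup>2"
proof -
  define d where "d = u - y - \<gamma> *\<^sub>R (B u - B w)"
  have "(1 / \<gamma>) *\<^sub>R (u - \<gamma> *\<^sub>R B u - y) - (- B w) = (1 / \<gamma>) *\<^sub>R d"
    using \<gamma> by (simp add: d_def algebra_simps)
  then have "0 \<le> (1 / \<gamma>) * ((y - w) \<bullet> d)" using monotone[OF y w] by simp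
  then have "0 \<le> (y - w) \<bullet> d" using \<gamma> by (simp add: zero_le_divide_iff)
  moreover have eq: "u - w - \<gamma> *\<^sub>R (B u - B w) = (y - w) + d" by (simp add: d_def)
  have "(norm (u - w - \<gamma> *\<^sub>R (B u - B w)))\<^sup>2 = (norm (y - w))\<^sup>2 + (norm d)\<^sup>2 + 2 * ((y - w) \<bullet> d)"
    using power2_norm_diff_scaleR[of "y - w" "-1" d] unfolding eq by simp
  moreover have "(norm (u - w - \<gamma> *\<^sub>R (B u - B w)))\<^sup>2
      \<le> (norm (u - w))\<^sup>2 - \<gamma> * (2 * \<beta> - \<gamma>) * (norm (B u - B w))\<^sup>2"
    using \<gamma> by (intro forward_step u graph_mem(1)[OF w]) simp
  ultimately show ?thesis unfolding d_def[symmetric] by linarith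
qed

text \<open>
  The monotonicity inequality against a fixed element of the graph pairs a weakly convergent
  factor with a strongly convergent one, so it passes to the limit; maximality does the rest.
\<close>

lemma weak_strong_closed:
  fixes Y V :: "'i \<Rightarrow> 'a"
  assumes F: "F \<noteq> bot" and YV: "\<And>i. (Y i, V i) \<in> A" and bdd: "\<And>i. norm (Y i) \<le> M"
    and Y: "\<forall>u\<in>H. ((\<lambda>i. Y i \<bullet> u) \<longlongrightarrow> w \<bullet> u) F" and V: "(V \<longlongrightarrow> v) F"
    and w: "w \<in> H" "v \<in> H"
  shows "(w, v) \<in> A"
proof (rule maximal[OF w])
  fix q r assume qr: "(q, r) \<in> A"
  have q: "q \<in> H" "r \<in> H" using graph_mem qr by auto
  have "((\<lambda>i. Y i \<bullet> V i) \<longlongrightarrow> w \<bullet> v) F"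
    by (rule inner_tendsto_weak_strong[OF Y bdd V w(2)])
  moreover have "((\<lambda>i. Y i \<bullet> r) \<longlongrightarrow> w \<bullet> r) F" using Y q by blast
  moreover have "((\<lambda>i. q \<bullet> (V i - r)) \<longlongrightarrow> q \<bullet> (v - r)) F" by (intro tendsto_intros V)
  ultimately have "((\<lambda>i. Y i \<bullet> V i - Y i \<bullet> r - q \<bullet> (V i - r)) \<longlongrightarrow> w \<bullet> v - w \<bullet> r - q \<bullet> (v - r)) F"
    by (intro tendsto_diff)
  moreover have "0 \<le> Y i \<bullet> V i - Y i \<bullet> r - q \<bullet> (V i - r)" for i
    using monotone[OF YV[of i] qr] by (simp add: inner_simps)
  ultimately have "0 \<le> w \<bullet> v - w \<bullet> r - q \<bullet> (v - r)"
    using F by (intro tendsto_lowerbound) auto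
  then show "0 \<le> (w - q) \<bullet> (v - r)" by (simp add: inner_simps)
qed

text \<open>
  \<open>t n\<close> is the error-free successor of \<open>x n\<close>, and \<open>c w n\<close> is the guaranteed decrease of the
  squared distance to a zero \<open>w\<close>. The distances \<open>norm (x n - w)\<close> converge, and \<open>norm (t n - w)\<close> is
  squeezed between two sequences with the same limit, so \<open>c w n\<close> tends to \<open>0\<close>. This forces
  \<open>B (x n)\<close> to \<open>B w\<close> and \<open>x n - y n\<close> to \<open>0\<close>, after which weak-strong closedness and Opial's
  argument apply.
\<close>

theorem forward_backward_summable_errors:
  assumes \<epsilon>: "0 < \<epsilon>" and \<gamma>: "\<And>n. \<gamma> n \<in> {\<epsilon>..2 * \<beta> - \<epsilon>}" and lam: "\<And>n. lam n \<in> {0..1 - \<epsilon>}"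
    and z: "(z, - B z) \<in> A" and x: "\<And>n. x n \<in> H"
    and y: "\<And>n. (y n, (1 / \<gamma> n) *\<^sub>R (x n - \<gamma> n *\<^sub>R B (x n) - y n)) \<in> A"
    and e: "\<And>n. norm (x (Suc n) - (lam n *\<^sub>R x n + (1 - lam n) *\<^sub>R y n)) \<le> e n" "summable e"
  obtains w where "(w, - B w) \<in> A" "weakly_converges_on H x w"
proof -
  have \<gamma>_pos: "0 < \<gamma> n" for n using \<gamma>[of n] \<epsilon> by auto
  have lam_le: "0 \<le> lam n" "\<epsilon> \<le> 1 - lam n" for n using lam[of n] by auto
  have e_nonneg: "0 \<le> e n" for n using e(1)[of n] norm_ge_zero order_trans by blast
  define t where "t n = lam n *\<^sub>R x n + (1 - lam n) *\<^sub>R y n" for n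
  define c where "c w n = \<epsilon> * (\<epsilon>\<^sup>2 * (norm (B (x n) - B w))\<^sup>2
    + (norm (x n - y n - \<gamma> n *\<^sub>R (B (x n) - B w)))\<^sup>2)" for w n
  have step: "(norm (t n - w))\<^sup>2 \<le> (norm (x n - w))\<^sup>2 - c w n" if w: "(w, - B w) \<in> A" for w n
  proof -
    let ?b = "(norm (B (x n) - B w))\<^sup>2" and ?d = "(norm (x n - y n - \<gamma> n *\<^sub>R (B (x n) - B w)))\<^sup>2"
    have "\<epsilon> * \<epsilon> \<le> \<gamma> n * (2 * \<beta> - \<gamma> n)" using \<gamma>[of n] \<epsilon> by (intro mult_mono) auto
    then have "\<epsilon>\<^sup>2 * ?b \<le> \<gamma> n * (2 * \<beta> - \<gamma> n) * ?b" by (intro mult_right_mono) (auto simp: power2_eq_square)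
    then have y_le: "(norm (y n - w))\<^sup>2 \<le> (norm (x n - w))\<^sup>2 - (\<epsilon>\<^sup>2 * ?b + ?d)"
      using forward_backward_step[OF w x y \<gamma>_pos, of n] by linarith
    have "t n - w = lam n *\<^sub>R (x n - w) + (1 - lam n) *\<^sub>R (y n - w)"
      by (simp add: t_def algebra_simps)
    then have "norm (t n - w) \<le> lam n * norm (x n - w) + (1 - lam n) * norm (y n - w)"
      using norm_triangle_ineq[of "lam n *\<^sub>R (x n - w)" "(1 - lam n) *\<^sub>R (y n - w)"] lam_le[of n] \<epsilon> by simp
    then have "(norm (t n - w))\<^sup>2 \<le> (lam n * norm (x n - w) + (1 - lam n) * norm (y n - w))\<^sup>2"
      by (rule power_mono) simp
    also have "\<dots> = lam n * (norm (x n - w))\<^sup>2 + (1 - lam n) * (norm (y n - w))\<^sup>2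
        - lam n * (1 - lam n) * (norm (x n - w) - norm (y n - w))\<^sup>2"
      by (simp add: power2_eq_square algebra_simps)
    also have "\<dots> \<le> lam n * (norm (x n - w))\<^sup>2 + (1 - lam n) * (norm (y n - w))\<^sup>2"
      using lam_le[of n] \<epsilon> by simp
    also have "\<dots> \<le> lam n * (norm (x n - w))\<^sup>2
        + (1 - lam n) * ((norm (x n - w))\<^sup>2 - (\<epsilon>\<^sup>2 * ?b + ?d))"
      using y_le lam_le[of n] \<epsilon> by (intro add_left_mono mult_left_mono) auto
    also have "\<dots> = (norm (x n - w))\<^sup>2 - (1 - lam n) * (\<epsilon>\<^sup>2 * ?b + ?d)" by (simp add: algebra_simps)
    also have "\<dots> \<le> (norm (x n - w))\<^sup>2 - \<epsilon> * (\<epsilon>\<^sup>2 * ?b + ?d)"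
      using lam_le[of n] by (intro diff_left_mono mult_right_mono) auto
    finally show ?thesis by (simp add: c_def)
  qed
  have c_nonneg: "0 \<le> c w n" for w n using \<epsilon> by (simp add: c_def)
  have t_le: "norm (t n - w) \<le> norm (x n - w)" if "(w, - B w) \<in> A" for w n
  proof -
    have "(norm (t n - w))\<^sup>2 \<le> (norm (x n - w))\<^sup>2" using step[OF that] c_nonneg by (smt (verit))
    then show ?thesis by (rule power2_le_imp_le) simp
  qed
  have x_le: "norm (x (Suc n) - w) \<le> norm (t n - w) + e n" for w n
    using norm_triangle_ineq[of "x (Suc n) - t n" "t n - w"] e(1)[of n] by (simp add: t_def)
  have conv: "convergent (\<lambda>n. norm (x n - w))" if "(w, - B w) \<in> A" for w
  proof (rule quasi_fejer_convergent[OF _ _ e_nonneg e(2)])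
    fix n show "norm (x (Suc n) - w) \<le> norm (x n - w) + e n"
      using x_le[of n w] t_le[OF that, of n] by linarith
  qed simp
  obtain l where l: "(\<lambda>n. norm (x n - z)) \<longlonglongrightarrow> l" using conv[OF z] by (auto simp: convergent_def)
  have e_lim: "e \<longlonglongrightarrow> 0" using e(2) by (rule summable_LIMSEQ_zero)
  have "(\<lambda>n. norm (x (Suc n) - z) - e n) \<longlonglongrightarrow> l - 0"
    by (rule tendsto_diff[OF LIMSEQ_Suc[OF l] e_lim])
  then have "(\<lambda>n. norm (x (Suc n) - z) - e n) \<longlonglongrightarrow> l" by simp
  then have t_lim: "(\<lambda>n. norm (t n - z)) \<longlonglongrightarrow> l"
    by (rule tendsto_sandwich[OF _ _ _ l, rotated 2])
      (auto intro!: always_eventually simp: diff_le_eq x_le t_le[OF z])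
  have c_lim: "c z \<longlonglongrightarrow> 0"
  proof (rule tendsto_sandwich[OF _ _ tendsto_const])
    show "eventually (\<lambda>n. c z n \<le> (norm (x n - z))\<^sup>2 - (norm (t n - z))\<^sup>2) sequentially"
    proof (rule always_eventually, rule allI)
      fix n show "c z n \<le> (norm (x n - z))\<^sup>2 - (norm (t n - z))\<^sup>2" using step[OF z, of n] by linarith
    qed
    have "(\<lambda>n. (norm (x n - z))\<^sup>2 - (norm (t n - z))\<^sup>2) \<longlonglongrightarrow> l\<^sup>2 - l\<^sup>2"
      by (intro tendsto_intros l t_lim)
    then show "(\<lambda>n. (norm (x n - z))\<^sup>2 - (norm (t n - z))\<^sup>2) \<longlonglongrightarrow> 0" by simp
  qed (use c_nonneg in auto)
  have sqrt_lim: "g \<longlonglongrightarrow> 0" if "\<And>n. K * (norm (g n))\<^sup>2 \<le> c z n" "0 < K" for g :: "nat \<Rightarrow> 'a" and K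
  proof -
    have "(\<lambda>n. (norm (g n))\<^sup>2) \<longlonglongrightarrow> 0"
    proof (rule tendsto_sandwich[OF _ _ tendsto_const])
      show "eventually (\<lambda>n. (norm (g n))\<^sup>2 \<le> c z n / K) sequentially"
        using that by (auto intro!: always_eventually simp: pos_le_divide_eq mult.commute)
      show "(\<lambda>n. c z n / K) \<longlonglongrightarrow> 0" using tendsto_divide_zero[OF c_lim] .
    qed auto
    then have "(\<lambda>n. sqrt ((norm (g n))\<^sup>2)) \<longlonglongrightarrow> sqrt 0" by (rule tendsto_real_sqrt)
    then show ?thesis by (simp add: tendsto_norm_zero_iff)
  qed
  have "(\<lambda>n. B (x n) - B z) \<longlonglongrightarrow> 0"
    by (rule sqrt_lim[of "\<epsilon> * \<epsilon>\<^sup>2"]) (use \<epsilon> in \<open>auto simp: c_def algebra_simps\<close>)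
  then have B_lim: "(\<lambda>n. B (x n)) \<longlonglongrightarrow> B z" by (rule iffD2[OF Lim_null])
  have "(\<lambda>n. x n - y n - \<gamma> n *\<^sub>R (B (x n) - B z)) \<longlonglongrightarrow> 0"
    by (rule sqrt_lim[of \<epsilon>]) (use \<epsilon> in \<open>auto simp: c_def algebra_simps\<close>)
  moreover have "(\<lambda>n. \<gamma> n *\<^sub>R (B (x n) - B z)) \<longlonglongrightarrow> 0"
  proof (rule Lim_null_comparison)
    show "eventually (\<lambda>n. norm (\<gamma> n *\<^sub>R (B (x n) - B z)) \<le> 2 * \<beta> * norm (B (x n) - B z)) sequentially"
    proof (rule always_eventually, rule allI)
      fix n show "norm (\<gamma> n *\<^sub>R (B (x n) - B z)) \<le> 2 * \<beta> * norm (B (x n) - B z)"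
        using \<gamma>[of n] \<epsilon> by (auto intro!: mult_right_mono)
    qed
    show "(\<lambda>n. 2 * \<beta> * norm (B (x n) - B z)) \<longlonglongrightarrow> 0"
      using \<open>(\<lambda>n. B (x n) - B z) \<longlonglongrightarrow> 0\<close> by (intro tendsto_mult_right_zero tendsto_norm_zero)
  qed
  ultimately have xy_lim: "(\<lambda>n. x n - y n) \<longlonglongrightarrow> 0" using tendsto_add by fastforce
  define v where "v n = (1 / \<gamma> n) *\<^sub>R (x n - \<gamma> n *\<^sub>R B (x n) - y n)" for n
  have "(\<lambda>n. (1 / \<gamma> n) *\<^sub>R (x n - y n)) \<longlonglongrightarrow> 0"
  proof (rule Lim_null_comparison)
    show "eventually (\<lambda>n. norm ((1 / \<gamma> n) *\<^sub>R (x n - y n)) \<le> (1 / \<epsilon>) * norm (x n - y n)) sequentially"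
    proof (rule always_eventually, rule allI)
      fix n
      have "1 / \<gamma> n \<le> 1 / \<epsilon>" "0 \<le> 1 / \<gamma> n" using \<gamma>[of n] \<epsilon> by (auto simp: frac_le)
      then show "norm ((1 / \<gamma> n) *\<^sub>R (x n - y n)) \<le> (1 / \<epsilon>) * norm (x n - y n)"
        unfolding norm_scaleR by (intro mult_right_mono) auto
    qed
    show "(\<lambda>n. (1 / \<epsilon>) * norm (x n - y n)) \<longlonglongrightarrow> 0"
      by (intro tendsto_mult_right_zero tendsto_norm_zero xy_lim)
  qed
  then have "(\<lambda>n. (1 / \<gamma> n) *\<^sub>R (x n - y n) - B (x n)) \<longlonglongrightarrow> 0 - B z"
    by (intro tendsto_diff B_lim)
  moreover have "(1 / \<gamma> n) *\<^sub>R (x n - y n) - B (x n) = v n" for n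
    using \<gamma>_pos[of n] by (simp add: v_def algebra_simps)
  ultimately have v_lim: "v \<longlonglongrightarrow> - B z" by simp
  have "Bseq (\<lambda>n. norm (x n - z))" using conv[OF z] by (rule convergent_imp_Bseq)
  then obtain R where R: "\<And>n. norm (x n - z) \<le> R" by (auto simp: Bseq_def)
  have x_bdd: "norm (x n) \<le> R + norm z" for n
    using R[of n] norm_triangle_ineq[of "x n - z" z] by simp
  obtain S where S: "\<And>n. norm (x n - y n) \<le> S"
    using convergent_imp_Bseq[OF convergentI[OF xy_lim]] by (auto simp: Bseq_def)
  have y_bdd: "norm (y n) \<le> R + norm z + S" for n
    using norm_triangle_ineq4[of "x n" "x n - y n"] x_bdd[of n] S[of n] by simp
  have zH: "z \<in> H" "B z \<in> H" using graph_mem[OF z] B_mem by auto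
  have cluster: "(w, - B w) \<in> A"
    if F: "F \<le> sequentially" "F \<noteq> bot" and w: "w \<in> H" "\<forall>u\<in>H. ((\<lambda>n. x n \<bullet> u) \<longlongrightarrow> w \<bullet> u) F" for F w
  proof -
    have lim_F: "(g \<longlongrightarrow> L) F" if "g \<longlonglongrightarrow> L" for g and L :: 'a
      using F(1) that by (rule tendsto_mono)
    have "((\<lambda>n. y n \<bullet> u) \<longlongrightarrow> w \<bullet> u) F" if "u \<in> H" for u
    proof -
      have "((\<lambda>n. x n \<bullet> u - (x n - y n) \<bullet> u) \<longlongrightarrow> w \<bullet> u - 0 \<bullet> u) F"
        using w(2) that by (intro tendsto_diff tendsto_inner[OF lim_F[OF xy_lim] tendsto_const]) blast
      then show ?thesis by (simp add: inner_simps)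
    qed
    then have *: "(w, - B z) \<in> A"
      using y zH mem(5) by (intro weak_strong_closed[OF F(2) _ y_bdd _ lim_F[OF v_lim] w(1)]) (auto simp: v_def)
    have Bw_lim: "((\<lambda>n. B (x n) - B w) \<longlongrightarrow> B z - B w) F"
      by (rule tendsto_diff[OF lim_F[OF B_lim] tendsto_const])
    have "((\<lambda>n. x n \<bullet> (B (x n) - B w)) \<longlongrightarrow> w \<bullet> (B z - B w)) F"
      by (rule inner_tendsto_weak_strong[OF w(2) x_bdd Bw_lim])
        (intro mem(3) B_mem zH w)
    moreover have "((\<lambda>n. w \<bullet> (B (x n) - B w)) \<longlongrightarrow> w \<bullet> (B z - B w)) F"
      by (intro tendsto_intros Bw_lim)
    ultimately have "((\<lambda>n. x n \<bullet> (B (x n) - B w) - w \<bullet> (B (x n) - B w))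
        \<longlongrightarrow> w \<bullet> (B z - B w) - w \<bullet> (B z - B w)) F" by (rule tendsto_diff)
    moreover have "((\<lambda>n. \<beta> * (norm (B (x n) - B w))\<^sup>2) \<longlongrightarrow> \<beta> * (norm (B z - B w))\<^sup>2) F"
      by (intro tendsto_intros Bw_lim)
    moreover have "\<beta> * (norm (B (x n) - B w))\<^sup>2 \<le> x n \<bullet> (B (x n) - B w) - w \<bullet> (B (x n) - B w)" for n
      using cocoercive[OF x w(1)] by (simp add: inner_diff_left)
    ultimately have "\<beta> * (norm (B z - B w))\<^sup>2 \<le> w \<bullet> (B z - B w) - w \<bullet> (B z - B w)"
      using F(2) by (intro tendsto_le[of F]) auto
    then have "B z = B w" using beta_pos by (simp add: mult_le_0_iff)
    with * show ?thesis by simp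
  qed
  obtain F w where F: "F \<le> sequentially" "F \<noteq> bot"
    and w: "w \<in> H" "\<forall>u\<in>H. ((\<lambda>n. x n \<bullet> u) \<longlongrightarrow> w \<bullet> u) F"
    by (rule bounded_family_weak_cluster[OF hilbert sequentially_bot x x_bdd])
  have "weakly_converges_on H x w"
    unfolding weakly_converges_on_def
  proof (intro conjI ballI)
    fix u assume u: "u \<in> H"
    show "(\<lambda>n. x n \<bullet> u) \<longlonglongrightarrow> w \<bullet> u"
    proof (rule ccontr)
      assume "\<not> ?thesis"
      then obtain r where r: "r > 0" "\<exists>\<^sub>F n in sequentially. r \<le> dist (x n \<bullet> u) (w \<bullet> u)"
        unfolding tendsto_iff by (auto simp: frequently_def not_le)
      \<comment> \<open>along \<open>G\<close> the inner products with \<open>u\<close> stay away from the limit, and yet \<open>G\<close> has a weak cluster point\<close>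
      define G where "G = inf sequentially (principal {n. r \<le> dist (x n \<bullet> u) (w \<bullet> u)})"
      have "G \<noteq> bot"
        using r(2) by (simp add: G_def trivial_limit_def eventually_inf_principal frequently_def)
      then obtain F' w' where F': "F' \<le> G" "F' \<noteq> bot"
        and w': "w' \<in> H" "\<forall>u\<in>H. ((\<lambda>n. x n \<bullet> u) \<longlongrightarrow> w' \<bullet> u) F'"
        by (rule bounded_family_weak_cluster[where x = x, OF hilbert _ x x_bdd])
      have F'_seq: "F' \<le> sequentially" using F'(1) by (simp add: G_def)
      have zeros: "(w, - B w) \<in> A" "(w', - B w') \<in> A"
        using cluster[OF F w] cluster[OF F'_seq F'(2) w'] .
      \<comment> \<open>Opial: the difference of the squared distances to two zeros is affine in \<open>x n\<close>\<close>
      obtain l1 l2 where "(\<lambda>n. norm (x n - w)) \<longlonglongrightarrow> l1" "(\<lambda>n. norm (x n - w')) \<longlonglongrightarrow> l2"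
        using conv[OF zeros(1)] conv[OF zeros(2)] by (auto simp: convergent_def)
      then have "(\<lambda>n. ((norm (x n - w'))\<^sup>2 - (norm (x n - w))\<^sup>2 + (norm w)\<^sup>2 - (norm w')\<^sup>2) / 2)
          \<longlonglongrightarrow> (l2\<^sup>2 - l1\<^sup>2 + (norm w)\<^sup>2 - (norm w')\<^sup>2) / 2" (is "_ \<longlonglongrightarrow> ?l")
        by (intro tendsto_intros) auto
      moreover have "((norm (x n - w'))\<^sup>2 - (norm (x n - w))\<^sup>2 + (norm w)\<^sup>2 - (norm w')\<^sup>2) / 2
          = x n \<bullet> (w - w')" for n
        by (simp add: power2_norm_eq_inner inner_simps inner_commute)
      ultimately have l: "(\<lambda>n. x n \<bullet> (w - w')) \<longlonglongrightarrow> ?l" by simp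
      have "w - w' \<in> H" using mem(3) w(1) w'(1) by blast
      then have "w \<bullet> (w - w') = ?l" "w' \<bullet> (w - w') = ?l"
        using tendsto_unique[OF F(2) _ tendsto_mono[OF F(1) l]] w(2)
          tendsto_unique[OF F'(2) _ tendsto_mono[OF F'_seq l]] w'(2) by auto
      then have "(w - w') \<bullet> (w - w') = 0" by (simp add: inner_diff_left)
      then have "w' = w" by simp
      then have "eventually (\<lambda>n. dist (x n \<bullet> u) (w \<bullet> u) < r) F'"
        using w'(2) u r(1) by (metis tendstoD)
      moreover have "eventually (\<lambda>n. r \<le> dist (x n \<bullet> u) (w \<bullet> u)) F'"
        by (rule filter_leD[OF F'(1)]) (simp add: G_def eventually_inf_principal)
      ultimately have "eventually (\<lambda>n. False) F'" by eventually_elim simp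
      then show False using F'(2) by simp
    qed
  qed (rule w(1))
  with cluster[OF F w] that show thesis by blast
qed

text \<open>
  \<open>J\<close> is the exact resolvent and \<open>R\<close> its nonexpansive approximation, which is good on bounded sets
  only; the two terms on the right of \<open>step\<close> stand for deviations of the relaxation parameters and
  for additive errors. The points \<open>t n\<close>, the forward steps from the zero \<open>z\<close>, stay in a fixed ball
  and \<open>J n\<close> maps them to \<open>z\<close>. Hence \<open>R n\<close> maps them close to \<open>z\<close>, and nonexpansiveness of \<open>R n\<close>
  bounds the distance of the iterates to \<open>z\<close>. Once the iterates are known to be bounded, replacing
  \<open>R\<close> by \<open>J\<close> costs a summable error.
\<close>

theorem perturbed_forward_backward:
  fixes J R :: "nat \<Rightarrow> 'a \<Rightarrow> 'a" and x b :: "nat \<Rightarrow> 'a" and \<gamma> lam \<mu> \<alpha> :: "nat \<Rightarrow> real"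
  defines "v \<equiv> \<lambda>n. x n - \<gamma> n *\<^sub>R (B (x n) + b n)"
  assumes \<epsilon>: "0 < \<epsilon>" and \<gamma>: "\<And>n. \<gamma> n \<in> {\<epsilon>..2 * \<beta> - \<epsilon>}" and lam: "\<And>n. lam n \<in> {0..1 - \<epsilon>}"
    and z: "(z, - B z) \<in> A" and x: "\<And>n. x n \<in> H" and b: "\<And>n. b n \<in> H"
    and J: "\<And>n u. u \<in> H \<Longrightarrow> (J n u, (1 / \<gamma> n) *\<^sub>R (u - J n u)) \<in> A"
    and R: "\<And>n u v. u \<in> H \<Longrightarrow> v \<in> H \<Longrightarrow> norm (R n u - R n v) \<le> norm (u - v)"
    and approx: "\<And>\<rho>. 0 < \<rho> \<Longrightarrow>
      \<exists>\<delta>. summable \<delta> \<and> (\<forall>n. \<forall>u\<in>H. norm u \<le> \<rho> \<longrightarrow> norm (R n u - J n u) \<le> \<delta> n)"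
    and step: "\<And>n. norm (x (Suc n) - (lam n *\<^sub>R x n + (1 - lam n) *\<^sub>R R n (v n)))
      \<le> \<mu> n * norm (x n - R n (v n)) + \<alpha> n"
    and \<mu>: "\<And>n. 0 \<le> \<mu> n" "summable \<mu>" and \<alpha>: "summable \<alpha>" "\<And>n. 0 \<le> \<alpha> n"
    and b_sum: "summable (\<lambda>n. norm (b n))"
  obtains w where "(w, - B w) \<in> A" "weakly_converges_on H x w"
proof -
  have \<gamma>_pos: "0 < \<gamma> n" "\<gamma> n \<le> 2 * \<beta>" for n using \<gamma>[of n] \<epsilon> by auto
  have lam_le: "0 \<le> lam n" "lam n \<le> 1" for n using lam[of n] \<epsilon> by auto
  have zH: "z \<in> H" "B z \<in> H" using graph_mem[OF z] B_mem by auto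
  have vH: "v n \<in> H" for n unfolding v_def by (intro mem x b B_mem)
  define t where "t n = z - \<gamma> n *\<^sub>R B z" for n
  have tH: "t n \<in> H" for n unfolding t_def by (intro mem zH)
  \<comment> \<open>the summand \<open>1\<close> only makes the radius positive\<close>
  define T where "T = norm z + 2 * \<beta> * norm (B z) + 1"
  have T_pos: "0 < T" using beta_pos by (auto simp: T_def intro!: add_nonneg_pos)
  have t_le: "norm (t n) \<le> T" for n
  proof -
    have "norm (t n) \<le> norm z + \<gamma> n * norm (B z)"
      using norm_triangle_ineq4[of z "\<gamma> n *\<^sub>R B z"] \<gamma>_pos[of n] by (simp add: t_def)
    also have "\<gamma> n * norm (B z) \<le> 2 * \<beta> * norm (B z)" using \<gamma>_pos[of n] by (intro mult_right_mono) auto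
    finally show ?thesis by (simp add: T_def)
  qed
  obtain \<delta>0 where \<delta>0: "summable \<delta>0" "\<And>n u. u \<in> H \<Longrightarrow> norm u \<le> T \<Longrightarrow> norm (R n u - J n u) \<le> \<delta>0 n"
    using approx[OF T_pos] by blast
  have Jt: "J n (t n) = z" for n
  proof -
    have "(1 / \<gamma> n) *\<^sub>R (t n - z) = - B z" using \<gamma>_pos[of n] by (simp add: t_def)
    then have "(z, (1 / \<gamma> n) *\<^sub>R (t n - z)) \<in> A" using z by simp
    from resolvent_nonexpansive[OF \<gamma>_pos(1) J[OF tH[of n]] this] show ?thesis by simp
  qed
  define r where "r n = norm (x n - z)" for n
  define s where "s n = 2 * \<beta> * norm (b n) + \<delta>0 n" for n
  have v_t: "norm (v n - t n) \<le> r n + 2 * \<beta> * norm (b n)" for n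
  proof -
    have "v n - t n = (x n - z - \<gamma> n *\<^sub>R (B (x n) - B z)) - \<gamma> n *\<^sub>R b n"
      by (simp add: v_def t_def algebra_simps)
    then have "norm (v n - t n) \<le> norm (x n - z - \<gamma> n *\<^sub>R (B (x n) - B z)) + \<gamma> n * norm (b n)"
      using norm_triangle_ineq4[of "x n - z - \<gamma> n *\<^sub>R (B (x n) - B z)" "\<gamma> n *\<^sub>R b n"] \<gamma>_pos[of n] by simp
    moreover have "norm (x n - z - \<gamma> n *\<^sub>R (B (x n) - B z)) \<le> r n"
      unfolding r_def using \<gamma>_pos[of n] by (intro forward_step_nonexpansive x zH) auto
    moreover have "\<gamma> n * norm (b n) \<le> 2 * \<beta> * norm (b n)" using \<gamma>_pos[of n] by (intro mult_right_mono) auto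
    ultimately show ?thesis by linarith
  qed
  have R_z: "norm (R n (v n) - z) \<le> r n + s n" for n
  proof -
    have "norm (R n (v n) - z) \<le> norm (R n (v n) - R n (t n)) + norm (R n (t n) - J n (t n))"
      using norm_triangle_ineq[of "R n (v n) - R n (t n)" "R n (t n) - z"] by (simp add: Jt)
    also have "\<dots> \<le> norm (v n - t n) + \<delta>0 n" by (intro add_mono R \<delta>0 vH tH t_le)
    finally show ?thesis using v_t[of n] by (simp add: s_def)
  qed
  have s_sum: "summable s" unfolding s_def by (intro summable_add summable_mult b_sum \<delta>0)
  have \<delta>0_nonneg: "0 \<le> \<delta>0 n" for n using \<delta>0(2)[OF tH t_le, of n n] norm_ge_zero order_trans by blast
  have s_nonneg: "0 \<le> s n" for n using \<delta>0_nonneg[of n] beta_pos by (simp add: s_def)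
  define S where "S = suminf s"
  have s_le: "s n \<le> S" for n
    using sum_le_suminf[OF s_sum, of "{n}"] s_nonneg by (simp add: S_def)
  have x_R: "norm (x n - R n (v n)) \<le> 2 * r n + S" for n
    using norm_triangle_ineq4[of "x n - z" "R n (v n) - z"] R_z[of n] s_le[of n] by (simp add: r_def)
  have r_nonneg: "0 \<le> r n" for n by (simp add: r_def)
  have r_step: "r (Suc n) \<le> (1 + 2 * \<mu> n) * r n + (s n + S * \<mu> n + \<alpha> n)" for n
  proof -
    let ?q = "lam n *\<^sub>R x n + (1 - lam n) *\<^sub>R R n (v n)"
    have "?q - z = lam n *\<^sub>R (x n - z) + (1 - lam n) *\<^sub>R (R n (v n) - z)" by (simp add: algebra_simps)
    then have "norm (?q - z) \<le> lam n * r n + (1 - lam n) * norm (R n (v n) - z)"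
      using norm_triangle_ineq[of "lam n *\<^sub>R (x n - z)" "(1 - lam n) *\<^sub>R (R n (v n) - z)"] lam_le[of n]
      by (simp add: r_def)
    also have "\<dots> \<le> lam n * r n + (1 - lam n) * (r n + s n)"
      using R_z lam_le[of n] by (intro add_left_mono mult_left_mono) auto
    also have "\<dots> = r n + (1 - lam n) * s n" by (simp add: algebra_simps)
    also have "(1 - lam n) * s n \<le> 1 * s n" using lam_le[of n] s_nonneg by (intro mult_right_mono) auto
    finally have "norm (?q - z) \<le> r n + s n" by simp
    moreover have "norm (x (Suc n) - ?q) \<le> \<mu> n * (2 * r n + S) + \<alpha> n"
      using step[of n] mult_left_mono[OF x_R \<mu>(1), of n n] by linarith
    moreover have "r (Suc n) \<le> norm (x (Suc n) - ?q) + norm (?q - z)"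
      using norm_triangle_ineq[of "x (Suc n) - ?q" "?q - z"] by (simp add: r_def)
    ultimately have "r (Suc n) \<le> \<mu> n * (2 * r n + S) + \<alpha> n + (r n + s n)" by linarith
    then show ?thesis by (simp add: algebra_simps)
  qed
  have S_nonneg: "0 \<le> S" using s_le[of 0] s_nonneg[of 0] by linarith
  obtain C where C: "\<forall>n. r n \<le> C"
  proof (rule quasi_fejer_bounded[where r = r and \<mu> = "\<lambda>n. 2 * \<mu> n" and s = "\<lambda>n. s n + S * \<mu> n + \<alpha> n"])
    show "summable (\<lambda>n. 2 * \<mu> n)" "summable (\<lambda>n. s n + S * \<mu> n + \<alpha> n)"
      by (intro summable_add summable_mult \<mu> \<alpha> s_sum)+
  qed (use r_step r_nonneg \<mu>(1) s_nonneg S_nonneg \<alpha>(2) in auto)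
  have C_nonneg: "0 \<le> C" using C r_nonneg order_trans by blast
  have b_le: "2 * \<beta> * norm (b n) \<le> S" for n
    using s_le[of n] \<delta>0_nonneg[of n] by (simp add: s_def)
  have v_le: "norm (v n) \<le> C + S + T" for n
  proof -
    have "norm (v n) \<le> norm (v n - t n) + norm (t n)" using norm_triangle_ineq[of "v n - t n" "t n"] by simp
    then show ?thesis using v_t[of n] t_le[of n] b_le[of n] C[rule_format, of n] by linarith
  qed
  have CST_pos: "0 < C + S + T" using T_pos S_nonneg C_nonneg by linarith
  obtain \<delta> where \<delta>: "summable \<delta>"
      "\<And>n u. u \<in> H \<Longrightarrow> norm u \<le> C + S + T \<Longrightarrow> norm (R n u - J n u) \<le> \<delta> n"
    using approx[OF CST_pos] by blast
  define y where "y n = J n (x n - \<gamma> n *\<^sub>R B (x n))" for n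
  have yH: "x n - \<gamma> n *\<^sub>R B (x n) \<in> H" for n by (intro mem x B_mem)
  have R_y: "norm (R n (v n) - y n) \<le> \<delta> n + 2 * \<beta> * norm (b n)" for n
  proof -
    have "norm (R n (v n) - y n) \<le> norm (R n (v n) - J n (v n)) + norm (J n (v n) - y n)"
      using norm_triangle_ineq[of "R n (v n) - J n (v n)" "J n (v n) - y n"] by simp
    moreover have "norm (R n (v n) - J n (v n)) \<le> \<delta> n" by (intro \<delta> vH v_le)
    moreover have "norm (J n (v n) - y n) \<le> norm (v n - (x n - \<gamma> n *\<^sub>R B (x n)))"
      unfolding y_def by (rule resolvent_nonexpansive[OF \<gamma>_pos(1) J[OF vH] J[OF yH]])
    moreover have "norm (v n - (x n - \<gamma> n *\<^sub>R B (x n))) = \<gamma> n * norm (b n)"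
      using \<gamma>_pos[of n] by (simp add: v_def algebra_simps)
    moreover have "\<gamma> n * norm (b n) \<le> 2 * \<beta> * norm (b n)" using \<gamma>_pos[of n] by (intro mult_right_mono) auto
    ultimately show ?thesis by linarith
  qed
  define e where "e n = (2 * C + S) * \<mu> n + \<alpha> n + (\<delta> n + 2 * \<beta> * norm (b n))" for n
  have e: "norm (x (Suc n) - (lam n *\<^sub>R x n + (1 - lam n) *\<^sub>R y n)) \<le> e n" for n
  proof -
    let ?q = "lam n *\<^sub>R x n + (1 - lam n) *\<^sub>R R n (v n)"
    have "x (Suc n) - (lam n *\<^sub>R x n + (1 - lam n) *\<^sub>R y n)
        = (x (Suc n) - ?q) + (1 - lam n) *\<^sub>R (R n (v n) - y n)" (is "?l = ?r") by (simp add: algebra_simps)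
    then have "norm ?l = norm ?r" by (rule arg_cong)
    then have "norm (x (Suc n) - (lam n *\<^sub>R x n + (1 - lam n) *\<^sub>R y n))
        \<le> norm (x (Suc n) - ?q) + (1 - lam n) * norm (R n (v n) - y n)"
      using norm_triangle_ineq[of "x (Suc n) - ?q" "(1 - lam n) *\<^sub>R (R n (v n) - y n)"] lam_le[of n] by simp
    moreover have "(1 - lam n) * norm (R n (v n) - y n) \<le> 1 * norm (R n (v n) - y n)"
      using lam_le[of n] by (intro mult_right_mono) auto
    moreover have "\<mu> n * norm (x n - R n (v n)) \<le> \<mu> n * (2 * C + S)"
      using x_R[of n] C[rule_format, of n] \<mu>(1) by (intro mult_left_mono) auto
    ultimately show ?thesis using step[of n] R_y[of n] by (simp add: e_def mult.commute)
  qed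
  have e_sum: "summable e" unfolding e_def by (intro summable_add summable_mult \<mu> \<alpha> \<delta> b_sum)
  show thesis
  proof (rule forward_backward_summable_errors[OF \<epsilon> \<gamma> lam z x _ e e_sum])
    show "(y n, (1 / \<gamma> n) *\<^sub>R (x n - \<gamma> n *\<^sub>R B (x n) - y n)) \<in> A" for n
      unfolding y_def by (rule J[OF yH])
  qed (rule that)
qed

end

section \<open>Direct sums of Hilbert spaces\<close>

text \<open>
  Finitely supported families with the sum of the componentwise inner products. The type need not
  be complete, but the families supported in a fixed finite index set with components in given
  Hilbert spaces form a complete subspace, \<open>family_space\<close>, which is the Hilbert direct sum of
  these spaces. One type thus serves every number of summands.
\<close>

typedef (overloaded) 'a direct_sum = "{f :: nat \<Rightarrow> 'a::real_inner. finite {i. f i \<noteq> 0}}"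
  morphisms component Abs_direct_sum
  by (rule exI[of _ "\<lambda>_. 0"]) simp

setup_lifting type_definition_direct_sum

lemma finite_support: "finite {i. component x i \<noteq> 0}"
  using component[of x] by simp

lemma direct_sum_eqI: "(\<And>i. component x i = component y i) \<Longrightarrow> x = y"
  by (simp add: component_inject[symmetric] fun_eq_iff)

instantiation direct_sum :: (real_inner) real_inner
begin

lift_definition zero_direct_sum :: "'a direct_sum" is "\<lambda>_. 0" by simp

lift_definition plus_direct_sum :: "'a direct_sum \<Rightarrow> 'a direct_sum \<Rightarrow> 'a direct_sum"
  is "\<lambda>x y i. x i + y i"
  by (erule rev_finite_subset[OF finite_UnI]) auto

lift_definition uminus_direct_sum :: "'a direct_sum \<Rightarrow> 'a direct_sum" is "\<lambda>x i. - x i" by simp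

lift_definition minus_direct_sum :: "'a direct_sum \<Rightarrow> 'a direct_sum \<Rightarrow> 'a direct_sum"
  is "\<lambda>x y i. x i - y i"
  by (erule rev_finite_subset[OF finite_UnI]) auto

lift_definition scaleR_direct_sum :: "real \<Rightarrow> 'a direct_sum \<Rightarrow> 'a direct_sum"
  is "\<lambda>r x i. r *\<^sub>R x i"
  by (erule rev_finite_subset) auto

definition inner_direct_sum :: "'a direct_sum \<Rightarrow> 'a direct_sum \<Rightarrow> real" where
  "inner_direct_sum x y = (\<Sum>i | component x i \<noteq> 0. component x i \<bullet> component y i)"

definition norm_direct_sum :: "'a direct_sum \<Rightarrow> real" where
  "norm_direct_sum x = sqrt (x \<bullet> x)"

definition sgn_direct_sum :: "'a direct_sum \<Rightarrow> 'a direct_sum" where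
  "sgn_direct_sum x = inverse (norm x) *\<^sub>R x"

definition dist_direct_sum :: "'a direct_sum \<Rightarrow> 'a direct_sum \<Rightarrow> real" where
  "dist_direct_sum x y = norm (x - y)"

definition uniformity_direct_sum :: "('a direct_sum \<times> 'a direct_sum) filter" where
  "uniformity_direct_sum = (INF e\<in>{0<..}. principal {(x, y). dist x y < e})"

definition open_direct_sum :: "'a direct_sum set \<Rightarrow> bool" where
  "open_direct_sum U \<longleftrightarrow> (\<forall>x\<in>U. eventually (\<lambda>(x', y). x' = x \<longrightarrow> y \<in> U) uniformity)"

lemmas component_simps =
  zero_direct_sum.rep_eq plus_direct_sum.rep_eq uminus_direct_sum.rep_eq
  minus_direct_sum.rep_eq scaleR_direct_sum.rep_eq

lemma inner_direct_sum_superset: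
  assumes "finite I" "\<And>i. i \<notin> I \<Longrightarrow> component x i = 0"
  shows "x \<bullet> y = (\<Sum>i\<in>I. component x i \<bullet> component y i)"
  unfolding inner_direct_sum_def using assms by (intro sum.mono_neutral_left) auto

instance
proof
  fix x y z :: "'a direct_sum" and r s :: real
  show "x + y + z = x + (y + z)" "x + y = y + x" "0 + x = x" "- x + x = 0" "x - y = x + - y"
    "r *\<^sub>R (x + y) = r *\<^sub>R x + r *\<^sub>R y" "(r + s) *\<^sub>R x = r *\<^sub>R x + s *\<^sub>R x"
    "r *\<^sub>R s *\<^sub>R x = (r * s) *\<^sub>R x" "1 *\<^sub>R x = x"
    by (auto intro!: direct_sum_eqI simp: component_simps algebra_simps)
  \<comment> \<open>a common finite index set turns all three inner products into sums over the same set\<close>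
  define I where "I = {i. component x i \<noteq> 0} \<union> {i. component y i \<noteq> 0}"
  have "finite I" by (simp add: I_def finite_support)
  have inner: "u \<bullet> v = (\<Sum>i\<in>I. component u i \<bullet> component v i)"
    if "\<And>i. i \<notin> I \<Longrightarrow> component u i = 0" for u v :: "'a direct_sum"
    using \<open>finite I\<close> that by (rule inner_direct_sum_superset)
  have "x \<bullet> y = (\<Sum>i\<in>I. component x i \<bullet> component y i)"
      "y \<bullet> x = (\<Sum>i\<in>I. component y i \<bullet> component x i)"
    by (intro inner; simp add: I_def)+
  then show "x \<bullet> y = y \<bullet> x" by (simp add: inner_commute)
  have "(x + y) \<bullet> z = (\<Sum>i\<in>I. component (x + y) i \<bullet> component z i)"
      "x \<bullet> z = (\<Sum>i\<in>I. component x i \<bullet> component z i)"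
      "y \<bullet> z = (\<Sum>i\<in>I. component y i \<bullet> component z i)"
    by (intro inner; simp add: I_def component_simps)+
  then show "(x + y) \<bullet> z = x \<bullet> z + y \<bullet> z"
    by (simp add: component_simps inner_add_left sum.distrib)
  have "(r *\<^sub>R x) \<bullet> y = (\<Sum>i\<in>I. component (r *\<^sub>R x) i \<bullet> component y i)"
      "x \<bullet> y = (\<Sum>i\<in>I. component x i \<bullet> component y i)"
    by (intro inner; simp add: I_def component_simps)+
  then show "(r *\<^sub>R x) \<bullet> y = r * (x \<bullet> y)"
    by (simp add: component_simps sum_distrib_left)
  show "0 \<le> x \<bullet> x"
    by (simp add: inner_direct_sum_def sum_nonneg)
  show "x \<bullet> x = 0 \<longleftrightarrow> x = 0"
  proof
    assume "x \<bullet> x = 0"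
    then have "\<forall>i\<in>{i. component x i \<noteq> 0}. component x i \<bullet> component x i = 0"
      unfolding inner_direct_sum_def by (subst (asm) sum_nonneg_eq_0_iff) (auto simp: finite_support)
    then show "x = 0" by (intro direct_sum_eqI) (auto simp: component_simps)
  qed (simp add: inner_direct_sum_def component_simps)
qed (simp_all add: sgn_direct_sum_def norm_direct_sum_def dist_direct_sum_def
    uniformity_direct_sum_def open_direct_sum_def)

end

lemma norm_component_le: "norm (component x i) \<le> norm x"
proof (cases "component x i = 0")
  case False
  then have "component x i \<bullet> component x i \<le> x \<bullet> x"
    unfolding inner_direct_sum_def by (intro member_le_sum) (auto simp: finite_support)
  then show ?thesis by (simp add: norm_eq_sqrt_inner)
qed simp

definition family :: "nat set \<Rightarrow> (nat \<Rightarrow> 'a::real_inner) \<Rightarrow> 'a direct_sum" where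
  "family I v = Abs_direct_sum (\<lambda>i. if i \<in> I then v i else 0)"

definition family_space :: "nat set \<Rightarrow> (nat \<Rightarrow> 'a::real_inner set) \<Rightarrow> 'a direct_sum set" where
  "family_space I H = {x. (\<forall>i\<in>I. component x i \<in> H i) \<and> (\<forall>i. i \<notin> I \<longrightarrow> component x i = 0)}"

lemma component_family:
  "finite I \<Longrightarrow> component (family I v) i = (if i \<in> I then v i else 0)"
  unfolding family_def by (subst Abs_direct_sum_inverse) (auto elim: rev_finite_subset)

lemma inner_on_family_space:
  assumes "finite I" "\<And>i. i \<notin> I \<Longrightarrow> component x i = 0"
  shows "x \<bullet> y = (\<Sum>i\<in>I. component x i \<bullet> component y i)"
    "(norm x)\<^sup>2 = (\<Sum>i\<in>I. (norm (component x i))\<^sup>2)"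
  using inner_direct_sum_superset[OF assms] by (simp_all add: power2_norm_eq_inner)

lemma norm_le_sum_components:
  assumes "finite I" "\<And>i. i \<notin> I \<Longrightarrow> component x i = 0"
  shows "norm x \<le> (\<Sum>i\<in>I. norm (component x i))"
proof (rule power2_le_imp_le)
  have "(norm x)\<^sup>2 = (\<Sum>i\<in>I. (norm (component x i))\<^sup>2)" by (rule inner_on_family_space[OF assms])
  also have "\<dots> = (L2_set (\<lambda>i. norm (component x i)) I)\<^sup>2" by (simp add: L2_set_def sum_nonneg)
  also have "\<dots> \<le> (\<Sum>i\<in>I. norm (component x i))\<^sup>2"
    by (intro power_mono L2_set_le_sum) (auto simp: L2_set_nonneg)
  finally show "(norm x)\<^sup>2 \<le> (\<Sum>i\<in>I. norm (component x i))\<^sup>2" .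
qed (simp add: sum_nonneg)

text \<open>
  Projections onto components do not increase norms, so components of a Cauchy sequence are
  Cauchy; the norm is at most the sum of the component norms, so componentwise limits are limits.
\<close>

lemma hilbert_family_space:
  assumes I: "finite I" and H: "\<And>i. i \<in> I \<Longrightarrow> hilbert_subspace (H i)"
  shows "hilbert_subspace (family_space I H)"
  unfolding hilbert_subspace_def
proof
  note HD = hilbert_subspaceD[OF H]
  show "subspace (family_space I H)"
    unfolding subspace_def family_space_def by (auto simp: component_simps HD)
  show "complete (family_space I H)"
    unfolding complete_def
  proof (intro allI impI)
    fix X assume X: "(\<forall>n. X n \<in> family_space I H) \<and> Cauchy X"
    have "\<exists>l\<in>H i. (\<lambda>n. component (X n) i) \<longlonglongrightarrow> l" if "i \<in> I" for i
    proof -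
      have "Cauchy (\<lambda>n. component (X n) i)"
        unfolding Cauchy_def
      proof (intro allI impI)
        fix e :: real assume "e > 0"
        then obtain N where "\<forall>m\<ge>N. \<forall>n\<ge>N. dist (X m) (X n) < e"
          using X unfolding Cauchy_def by blast
        moreover have "dist (component (X m) i) (component (X n) i) \<le> dist (X m) (X n)" for m n
          using norm_component_le[of "X m - X n" i] by (simp add: dist_norm component_simps)
        ultimately show "\<exists>N. \<forall>m\<ge>N. \<forall>n\<ge>N. dist (component (X m) i) (component (X n) i) < e"
          by (meson order_le_less_trans)
      qed
      moreover have "\<forall>n. component (X n) i \<in> H i" using X that by (auto simp: family_space_def)
      ultimately show ?thesis using HD(2)[OF that] unfolding complete_def
        by (elim allE[of _ "\<lambda>n. component (X n) i"]) simp
    qed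
    then obtain l where l: "\<And>i. i \<in> I \<Longrightarrow> l i \<in> H i" "\<And>i. i \<in> I \<Longrightarrow> (\<lambda>n. component (X n) i) \<longlonglongrightarrow> l i"
      by metis
    have "X \<longlonglongrightarrow> family I l"
    proof (rule iffD2[OF Lim_null], rule Lim_null_comparison)
      show "eventually (\<lambda>n. norm (X n - family I l) \<le> (\<Sum>i\<in>I. norm (component (X n) i - l i))) sequentially"
      proof (rule always_eventually, rule allI)
        fix n
        have "norm (X n - family I l) \<le> (\<Sum>i\<in>I. norm (component (X n - family I l) i))"
          using X by (intro norm_le_sum_components I) (auto simp: component_simps component_family I family_space_def)
        then show "norm (X n - family I l) \<le> (\<Sum>i\<in>I. norm (component (X n) i - l i))"
          by (simp add: component_simps component_family I)
      qed
      have "(\<lambda>n. \<Sum>i\<in>I. norm (component (X n) i - l i)) \<longlonglongrightarrow> (\<Sum>i\<in>I. norm (l i - l i))"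
        by (intro tendsto_sum tendsto_norm tendsto_diff l tendsto_const)
      then show "(\<lambda>n. \<Sum>i\<in>I. norm (component (X n) i - l i)) \<longlonglongrightarrow> 0" by simp
    qed
    moreover have "family I l \<in> family_space I H" using l by (simp add: family_space_def component_family I)
    ultimately show "\<exists>l\<in>family_space I H. X \<longlonglongrightarrow> l" by blast
  qed
qed

section \<open>Convex functions with Lipschitz gradient\<close>

text \<open>
  The derivative within \<open>G\<close> exists as a functional on the whole type and is determined along \<open>G\<close>
  only. Its Riesz representative \<open>g\<close> in \<open>G\<close> is again a derivative within \<open>G\<close>, because increments
  between points of \<open>G\<close> lie in \<open>G\<close>. It is unique in \<open>G\<close>: for another representative \<open>g'\<close>, the
  derivatives along the line through \<open>x\<close> in direction \<open>g' - g\<close> agree, so \<open>g' - g\<close> is orthogonal to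
  itself.
\<close>

lemma gradient_on:
  assumes G: "hilbert_subspace G" and diff: "\<phi> differentiable_on G" and x: "x \<in> G"
  shows "gradient G \<phi> x \<in> G" "(\<phi> has_derivative (\<lambda>h. gradient G \<phi> x \<bullet> h)) (at x within G)"
proof -
  note GD = hilbert_subspaceD[OF G]
  obtain D where D: "(\<phi> has_derivative D) (at x within G)"
    using diff x unfolding differentiable_on_def differentiable_def by blast
  then have bl: "bounded_linear D" by (rule has_derivative_bounded_linear)
  obtain K where K: "\<And>h. norm (D h) \<le> norm h * K" using bounded_linear.bounded[OF bl] by blast
  obtain g where g: "g \<in> G" "\<forall>h\<in>G. D h = g \<bullet> h"
  proof (rule riesz_representation_on[OF G])
    show "D (u + v) = D u + D v" for u v using bl by (simp add: bounded_linear.linear linear_add)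
    show "D (r *\<^sub>R u) = r * D u" for r u using bl by (simp add: bounded_linear.linear linear_scale)
    show "\<bar>D u\<bar> \<le> K * norm u" for u using K[of u] by (simp add: mult.commute)
  qed
  have repr: "(\<phi> has_derivative (\<lambda>h. g \<bullet> h)) (at x within G)"
    unfolding has_derivative_within
  proof
    show "bounded_linear ((\<bullet>) g)" by (rule bounded_linear_inner_right)
    have "((\<lambda>y. (1 / norm (y - x)) *\<^sub>R (\<phi> y - (\<phi> x + D (y - x)))) \<longlongrightarrow> 0) (at x within G)"
      using D by (simp add: has_derivative_within)
    moreover have "eventually (\<lambda>y. (1 / norm (y - x)) *\<^sub>R (\<phi> y - (\<phi> x + D (y - x)))
        = (1 / norm (y - x)) *\<^sub>R (\<phi> y - (\<phi> x + g \<bullet> (y - x)))) (at x within G)"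
      unfolding eventually_at_filter by (rule always_eventually) (use g GD(5) x in metis)
    ultimately show "((\<lambda>y. (1 / norm (y - x)) *\<^sub>R (\<phi> y - (\<phi> x + g \<bullet> (y - x)))) \<longlongrightarrow> 0) (at x within G)"
      by (rule Lim_transform_eventually)
  qed
  have unique: "g' = g" if g': "g' \<in> G" "(\<phi> has_derivative (\<lambda>h. g' \<bullet> h)) (at x within G)" for g'
  proof -
    have line: "((\<lambda>t. \<phi> (x + t *\<^sub>R (g' - g))) has_derivative (\<lambda>s. k \<bullet> (s *\<^sub>R (g' - g)))) (at 0)"
      if "(\<phi> has_derivative (\<lambda>h. k \<bullet> h)) (at x within G)" for k
    proof -
      have "((\<lambda>t::real. x + t *\<^sub>R (g' - g)) has_derivative (\<lambda>s. s *\<^sub>R (g' - g))) (at 0 within UNIV)"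
        by (auto intro!: derivative_eq_intros)
      moreover have "(\<phi> has_derivative (\<lambda>h. k \<bullet> h)) (at (x + 0 *\<^sub>R (g' - g)) within G)"
        using that by simp
      then have "(\<phi> has_derivative (\<lambda>h. k \<bullet> h)) (at (x + 0 *\<^sub>R (g' - g)) within range (\<lambda>t. x + t *\<^sub>R (g' - g)))"
        by (rule has_derivative_subset) (use GD(4-6) x g(1) g'(1) in auto)
      ultimately show ?thesis by (rule has_derivative_in_compose)
    qed
    have "(\<lambda>s. g' \<bullet> (s *\<^sub>R (g' - g))) = (\<lambda>s. g \<bullet> (s *\<^sub>R (g' - g)))"
      using line[OF g'(2)] line[OF repr] by (rule has_derivative_unique)
    from fun_cong[OF this, of 1] have "(g' - g) \<bullet> (g' - g) = 0" by (simp add: inner_diff_left)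
    then show ?thesis by simp
  qed
  have "gradient G \<phi> x = g"
    unfolding gradient_def using g repr unique by (intro the_equality) blast+
  then show "gradient G \<phi> x \<in> G" "(\<phi> has_derivative (\<lambda>h. gradient G \<phi> x \<bullet> h)) (at x within G)"
    using g repr by auto
qed

lemma gradient_along_line:
  assumes G: "hilbert_subspace G" and diff: "\<phi> differentiable_on G" and x: "x \<in> G" and d: "d \<in> G"
  shows "((\<lambda>t. \<phi> (x + t *\<^sub>R d)) has_real_derivative gradient G \<phi> (x + t *\<^sub>R d) \<bullet> d) (at t)"
proof -
  note GD = hilbert_subspaceD[OF G]
  have "((\<lambda>t::real. x + t *\<^sub>R d) has_derivative (\<lambda>s. s *\<^sub>R d)) (at t within UNIV)"
    by (auto intro!: derivative_eq_intros)
  moreover have "x + t *\<^sub>R d \<in> G" by (intro GD x d)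
  then have "(\<phi> has_derivative (\<lambda>h. gradient G \<phi> (x + t *\<^sub>R d) \<bullet> h)) (at (x + t *\<^sub>R d) within G)"
    by (rule gradient_on(2)[OF G diff])
  then have "(\<phi> has_derivative (\<lambda>h. gradient G \<phi> (x + t *\<^sub>R d) \<bullet> h))
      (at (x + t *\<^sub>R d) within range (\<lambda>t. x + t *\<^sub>R d))"
    by (rule has_derivative_subset) (use GD(4,6) x d in auto)
  ultimately have "((\<lambda>t. \<phi> (x + t *\<^sub>R d)) has_derivative
      (\<lambda>s. gradient G \<phi> (x + t *\<^sub>R d) \<bullet> (s *\<^sub>R d))) (at t)"
    by (rule has_derivative_in_compose)
  then show ?thesis by (simp add: has_field_derivative_def mult.commute[of _ "gradient _ _ _ \<bullet> _"])
qed

lemma convex_gradient_ineq: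
  assumes G: "hilbert_subspace G" and diff: "\<phi> differentiable_on G" and conv: "convex_on G \<phi>"
    and x: "x \<in> G" and y: "y \<in> G"
  shows "\<phi> x + gradient G \<phi> x \<bullet> (y - x) \<le> \<phi> y"
proof -
  note GD = hilbert_subspaceD[OF G]
  define \<psi> where "\<psi> t = \<phi> (x + t *\<^sub>R (y - x))" for t
  have on_G: "x + t *\<^sub>R (y - x) \<in> G" for t by (intro GD x y)
  have "convex_on UNIV \<psi>"
  proof (rule convex_onI)
    fix t a b :: real assume t: "0 < t" "t < 1"
    have "x + ((1 - t) *\<^sub>R a + t *\<^sub>R b) *\<^sub>R (y - x)
        = (1 - t) *\<^sub>R (x + a *\<^sub>R (y - x)) + t *\<^sub>R (x + b *\<^sub>R (y - x))"
      by (simp add: algebra_simps)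
    then show "\<psi> ((1 - t) *\<^sub>R a + t *\<^sub>R b) \<le> (1 - t) * \<psi> a + t * \<psi> b"
      unfolding \<psi>_def using convex_onD[OF conv _ _ on_G on_G] t by simp
  qed simp
  moreover have "(\<psi> has_real_derivative gradient G \<phi> x \<bullet> (y - x)) (at 0 within UNIV)"
    unfolding \<psi>_def using gradient_along_line[OF G diff x GD(5)[OF y x], of 0] by simp
  ultimately have "(gradient G \<phi> x \<bullet> (y - x)) * (1 - 0) \<le> \<psi> 1 - \<psi> 0"
    by (intro convex_on_imp_above_tangent[of UNIV]) auto
  then show ?thesis by (simp add: \<psi>_def)
qed

text \<open>
  Along the segment from \<open>x\<close> to \<open>y\<close>, the difference \<open>h\<close> of the two sides, up to a constant, has a
  nonpositive derivative by the Lipschitz bound.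
\<close>

lemma lipschitz_gradient_descent:
  assumes G: "hilbert_subspace G" and diff: "\<phi> differentiable_on G"
    and lip: "lipschitz_on \<tau> G (gradient G \<phi>)" and x: "x \<in> G" and y: "y \<in> G"
  shows "\<phi> y \<le> \<phi> x + gradient G \<phi> x \<bullet> (y - x) + \<tau> / 2 * (norm (y - x))\<^sup>2"
proof -
  note GD = hilbert_subspaceD[OF G]
  let ?g = "gradient G \<phi>"
  have d: "y - x \<in> G" by (intro GD x y)
  define h where "h t = \<phi> (x + t *\<^sub>R (y - x)) - t * (?g x \<bullet> (y - x)) - \<tau> / 2 * t\<^sup>2 * (norm (y - x))\<^sup>2" for t
  have "h 1 \<le> h 0"
  proof (rule DERIV_nonpos_imp_nonincreasing[of 0 1 h])
    fix t :: real assume t: "0 \<le> t" "t \<le> 1"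
    let ?d = "?g (x + t *\<^sub>R (y - x)) \<bullet> (y - x) - ?g x \<bullet> (y - x) - \<tau> * t * (norm (y - x))\<^sup>2"
    have "(h has_real_derivative ?d) (at t)"
      unfolding h_def by (auto intro!: derivative_eq_intros gradient_along_line[OF G diff x d])
    moreover have "?d \<le> 0"
    proof -
      have "(?g (x + t *\<^sub>R (y - x)) - ?g x) \<bullet> (y - x) \<le> norm (?g (x + t *\<^sub>R (y - x)) - ?g x) * norm (y - x)"
        by (rule norm_cauchy_schwarz)
      also have "norm (?g (x + t *\<^sub>R (y - x)) - ?g x) \<le> \<tau> * norm (t *\<^sub>R (y - x))"
        using lipschitz_onD[OF lip, of "x + t *\<^sub>R (y - x)" x] GD(4)[OF x GD(6)[OF d]] x
        by (simp add: dist_norm)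
      then have "norm (?g (x + t *\<^sub>R (y - x)) - ?g x) * norm (y - x) \<le> \<tau> * norm (t *\<^sub>R (y - x)) * norm (y - x)"
        by (rule mult_right_mono) simp
      also have "\<tau> * norm (t *\<^sub>R (y - x)) * norm (y - x) = \<tau> * t * (norm (y - x))\<^sup>2"
        unfolding norm_scaleR power2_eq_square using t by simp
      finally show ?thesis unfolding inner_diff_left by linarith
    qed
    ultimately show "\<exists>y. (h has_real_derivative y) (at t) \<and> y \<le> 0" by blast
  qed simp
  then show ?thesis by (simp add: h_def)
qed

text \<open>
  The function \<open>v \<mapsto> \<phi> v - \<nabla>\<phi> u \<bullet> v\<close> is convex with minimum at \<open>u\<close>. A gradient step of length
  \<open>1 / \<tau>\<close> from \<open>v\<close> decreases it by at least \<open>(norm (\<nabla>\<phi> v - \<nabla>\<phi> u))\<^sup>2 / (2 * \<tau>)\<close>, which is therefore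
  a lower bound for its excess at \<open>v\<close> over the minimum. Adding the two inequalities with \<open>u\<close> and
  \<open>v\<close> exchanged gives cocoercivity.
\<close>

lemma baillon_haddad:
  assumes G: "hilbert_subspace G" and diff: "\<phi> differentiable_on G" and conv: "convex_on G \<phi>"
    and lip: "lipschitz_on \<tau> G (gradient G \<phi>)" and \<tau>: "0 < \<tau>" and x: "x \<in> G" and y: "y \<in> G"
  shows "(norm (gradient G \<phi> x - gradient G \<phi> y))\<^sup>2 / \<tau> \<le> (x - y) \<bullet> (gradient G \<phi> x - gradient G \<phi> y)"
proof -
  note GD = hilbert_subspaceD[OF G]
  let ?g = "gradient G \<phi>"
  have half: "\<phi> u + ?g u \<bullet> (v - u) + (norm (?g v - ?g u))\<^sup>2 / (2 * \<tau>) \<le> \<phi> v" if u: "u \<in> G" "v \<in> G" for u v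
  proof -
    let ?k = "?g v - ?g u"
    \<comment> \<open>the gradient step from \<open>v\<close> for \<open>v \<mapsto> \<phi> v - \<nabla>\<phi> u \<bullet> v\<close>\<close>
    define w where "w = v - (1 / \<tau>) *\<^sub>R ?k"
    have w: "w \<in> G" unfolding w_def using u gradient_on(1)[OF G diff] by (intro GD) auto
    have wv: "w - v = - ((1 / \<tau>) *\<^sub>R ?k)" by (simp add: w_def)
    have "(norm (w - v))\<^sup>2 = (norm ?k)\<^sup>2 / \<tau>\<^sup>2" using \<tau> by (simp add: wv power_divide)
    then have "\<phi> w \<le> \<phi> v + ?g v \<bullet> (w - v) + (norm ?k)\<^sup>2 / (2 * \<tau>)"
      using lipschitz_gradient_descent[OF G diff lip u(2) w] \<tau> by (simp add: power2_eq_square)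
    moreover have "\<phi> u + ?g u \<bullet> (w - u) \<le> \<phi> w" by (rule convex_gradient_ineq[OF G diff conv u(1) w])
    moreover have "?g u \<bullet> (w - u) = ?g u \<bullet> (w - v) + ?g u \<bullet> (v - u)" by (simp add: inner_diff_right)
    moreover have "?g v \<bullet> (w - v) - ?g u \<bullet> (w - v) = - ((norm ?k)\<^sup>2 / \<tau>)"
      by (simp add: wv power2_norm_eq_inner inner_diff_left diff_divide_distrib)
    moreover have "(norm ?k)\<^sup>2 / \<tau> = 2 * ((norm ?k)\<^sup>2 / (2 * \<tau>))" by simp
    ultimately show ?thesis by linarith
  qed
  have "(norm (?g x - ?g y))\<^sup>2 / (2 * \<tau>) + (norm (?g x - ?g y))\<^sup>2 / (2 * \<tau>)
      \<le> - (?g x \<bullet> (y - x)) - ?g y \<bullet> (x - y)"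
    using half[OF x y] half[OF y x] by (simp add: norm_minus_commute)
  then show ?thesis by (simp add: inner_diff_left inner_diff_right inner_commute)
qed

section \<open>Operator norms and adjoints\<close>

lemma bounded_linear_onD:
  assumes "bounded_linear_on H G L"
  shows "\<And>x. x \<in> H \<Longrightarrow> L x \<in> G" "\<And>x y. x \<in> H \<Longrightarrow> y \<in> H \<Longrightarrow> L (x + y) = L x + L y"
    "\<And>x r. x \<in> H \<Longrightarrow> L (r *\<^sub>R x) = r *\<^sub>R L x"
  using assms by (auto simp: bounded_linear_on_def)

lemma onorm_on_bound:
  assumes H: "hilbert_subspace H" and L: "bounded_linear_on H G L"
  shows "0 \<le> onorm_on H L" "x \<in> H \<Longrightarrow> norm (L x) \<le> onorm_on H L * norm x"
proof -
  note HD = hilbert_subspaceD[OF H]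
  obtain K where K: "\<forall>x\<in>H. norm (L x) \<le> K * norm x"
    using L by (auto simp: bounded_linear_on_def)
  have "norm (L x) / norm x \<le> \<bar>K\<bar>" if x: "x \<in> H" for x
  proof (cases "x = 0")
    case False
    have "norm (L x) \<le> \<bar>K\<bar> * norm x"
      using K x mult_right_mono[OF abs_ge_self[of K], of "norm x"] by force
    then show ?thesis using False by (simp add: pos_divide_le_eq)
  qed simp
  then have bdd: "bdd_above ((\<lambda>x. norm (L x) / norm x) ` H)" by (auto intro!: bdd_aboveI2)
  have le: "norm (L x) / norm x \<le> onorm_on H L" if "x \<in> H" for x
    unfolding onorm_on_def by (rule cSUP_upper[OF that bdd])
  from le[OF HD(3)] show "0 \<le> onorm_on H L" by simp
  assume x: "x \<in> H"
  show "norm (L x) \<le> onorm_on H L * norm x"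
  proof (cases "x = 0")
    case True
    then show ?thesis using K x by auto
  next
    case False
    then show ?thesis using le[OF x] by (simp add: pos_divide_le_eq)
  qed
qed

lemma adjoint_on:
  assumes H: "hilbert_subspace H" and L: "bounded_linear_on H G L"
  shows "adjoint_on H L y \<in> H" "z \<in> H \<Longrightarrow> z \<bullet> adjoint_on H L y = L z \<bullet> y"
    "norm (adjoint_on H L y) \<le> onorm_on H L * norm y"
proof -
  note HD = hilbert_subspaceD[OF H]
  obtain w where w: "w \<in> H" "\<forall>u\<in>H. L u \<bullet> y = w \<bullet> u"
  proof (rule riesz_representation_on[OF H, of "\<lambda>u. L u \<bullet> y"])
    fix u assume u: "u \<in> H"
    have "\<bar>L u \<bullet> y\<bar> \<le> norm (L u) * norm y" by (rule Cauchy_Schwarz_ineq2)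
    also have "\<dots> \<le> onorm_on H L * norm u * norm y"
      using onorm_on_bound(2)[OF H L u] by (intro mult_right_mono) auto
    finally show "\<bar>L u \<bullet> y\<bar> \<le> (onorm_on H L * norm y) * norm u" by (simp add: mult_ac)
  qed (auto simp: bounded_linear_onD[OF L] inner_simps)
  have "adjoint_on H L y = w"
    unfolding adjoint_on_def
  proof (rule the_equality)
    show "w \<in> H \<and> (\<forall>z\<in>H. L z \<bullet> y = z \<bullet> w)" using w by (simp add: inner_commute)
    fix w' assume w': "w' \<in> H \<and> (\<forall>z\<in>H. L z \<bullet> y = z \<bullet> w')"
    have "w' - w \<in> H" using w(1) w' by (intro HD(5)) auto
    then have "(w' - w) \<bullet> (w' - w) = 0"
      using w w' by (metis inner_commute inner_diff_right right_minus_eq)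
    then show "w' = w" by simp
  qed
  then show mem: "adjoint_on H L y \<in> H" and adj: "z \<in> H \<Longrightarrow> z \<bullet> adjoint_on H L y = L z \<bullet> y" for z
    using w by (auto simp: inner_commute)
  let ?a = "adjoint_on H L y"
  have "norm ?a * norm ?a = L ?a \<bullet> y"
    using adj[OF mem] by (simp add: power2_norm_eq_inner flip: power2_eq_square)
  also have "\<dots> \<le> norm (L ?a) * norm y" by (rule norm_cauchy_schwarz)
  also have "\<dots> \<le> onorm_on H L * norm ?a * norm y"
    using onorm_on_bound(2)[OF H L mem] by (intro mult_right_mono) auto
  finally have le: "norm ?a * norm ?a \<le> norm ?a * (onorm_on H L * norm y)" by (simp add: mult_ac)
  show "norm ?a \<le> onorm_on H L * norm y"
  proof (cases "?a = 0")
    case True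
    then show ?thesis using onorm_on_bound(1)[OF H L] by simp
  next
    case False
    then show ?thesis using mult_left_le_imp_le[OF le] by simp
  qed
qed

lemma adjoint_on_diff:
  assumes H: "hilbert_subspace H" and L: "bounded_linear_on H G L"
  shows "adjoint_on H L (u - v) = adjoint_on H L u - adjoint_on H L v"
proof -
  note adj = adjoint_on[OF H L]
  let ?w = "adjoint_on H L (u - v) - (adjoint_on H L u - adjoint_on H L v)"
  have "?w \<in> H" by (intro hilbert_subspaceD(5)[OF H] adj)
  then have "?w \<bullet> ?w = 0" by (simp add: inner_diff_right[of ?w] adj(2)) (simp add: inner_diff_right)
  then show ?thesis by simp
qed

section \<open>The coupled minimization problem\<close>

locale coupled_problem =
  fixes m p :: nat
    and H :: "nat \<Rightarrow> 'h::real_inner set"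
    and G :: "nat \<Rightarrow> 'g::real_inner set"
    and f :: "nat \<Rightarrow> 'h \<Rightarrow> ereal"
    and \<tau> :: "nat \<Rightarrow> real"
    and \<phi> :: "nat \<Rightarrow> 'g \<Rightarrow> real"
    and L :: "nat \<Rightarrow> nat \<Rightarrow> 'h \<Rightarrow> 'g"
  assumes p: "p \<ge> 1"
    and H: "\<And>i. i \<in> {1..m} \<Longrightarrow> hilbert_subspace (H i)"
    and G: "\<And>k. k \<in> {1..p} \<Longrightarrow> hilbert_subspace (G k)"
    and f: "\<And>i. i \<in> {1..m} \<Longrightarrow> f i \<in> Gamma0 (H i)"
    and tau: "\<And>k. k \<in> {1..p} \<Longrightarrow> \<tau> k > 0"
    and phi_convex: "\<And>k. k \<in> {1..p} \<Longrightarrow> convex_on (G k) (\<phi> k)"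
    and phi_diff: "\<And>k. k \<in> {1..p} \<Longrightarrow> \<phi> k differentiable_on G k"
    and phi_lipschitz: "\<And>k. k \<in> {1..p} \<Longrightarrow> lipschitz_on (\<tau> k) (G k) (gradient (G k) (\<phi> k))"
    and L: "\<And>k i. k \<in> {1..p} \<Longrightarrow> i \<in> {1..m} \<Longrightarrow> bounded_linear_on (H i) (G k) (L k i)"
begin

definition feasible :: "(nat \<Rightarrow> 'h) \<Rightarrow> bool" where
  "feasible x \<longleftrightarrow> (\<forall>i\<in>{1..m}. x i \<in> H i)"

definition coupling :: "nat \<Rightarrow> (nat \<Rightarrow> 'h) \<Rightarrow> 'g" where
  "coupling k x = (\<Sum>i=1..m. L k i (x i))"

definition smooth_part :: "(nat \<Rightarrow> 'h) \<Rightarrow> real" where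
  "smooth_part x = (\<Sum>k=1..p. \<phi> k (coupling k x))"

definition partial_gradient :: "(nat \<Rightarrow> 'h) \<Rightarrow> nat \<Rightarrow> 'h" where
  "partial_gradient x i = (\<Sum>k=1..p. adjoint_on (H i) (L k i) (gradient (G k) (\<phi> k) (coupling k x)))"

lemma feasibleD: "feasible x \<Longrightarrow> i \<in> {1..m} \<Longrightarrow> x i \<in> H i"
  by (simp add: feasible_def)

lemma coupling_mem: "feasible x \<Longrightarrow> k \<in> {1..p} \<Longrightarrow> coupling k x \<in> G k"
  unfolding coupling_def
  by (intro subspace_sum hilbert_subspaceD(1)[OF G] bounded_linear_onD(1)[OF L] feasibleD)

lemma coupling_diff:
  assumes "feasible x" "feasible y" "k \<in> {1..p}"
  shows "coupling k (\<lambda>i. x i - y i) = coupling k x - coupling k y"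
proof -
  have "L k i (x i - y i) = L k i (x i) - L k i (y i)" if i: "i \<in> {1..m}" for i
  proof -
    note LD = bounded_linear_onD[OF L[OF assms(3) i]]
    \<comment> \<open>\<open>L k i\<close> is additive and homogeneous on \<open>H i\<close> only, so subtraction is read as adding a multiple\<close>
    have "L k i (x i + (-1) *\<^sub>R y i) = L k i (x i) + (-1) *\<^sub>R L k i (y i)"
      using LD feasibleD[OF assms(1) i] feasibleD[OF assms(2) i] hilbert_subspaceD(6)[OF H[OF i]]
      by (metis)
    then show ?thesis by simp
  qed
  then show ?thesis unfolding coupling_def by (simp flip: sum_subtractf)
qed

lemma partial_gradient_mem: "i \<in> {1..m} \<Longrightarrow> partial_gradient x i \<in> H i"
  unfolding partial_gradient_def
  by (intro subspace_sum hilbert_subspaceD(1)[OF H] adjoint_on(1)[OF H L])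

text \<open>
  The adjoint of the map \<open>h \<mapsto> (coupling k h)\<^sub>k\<close>, written out.
\<close>

lemma inner_adjoint_sum:
  assumes "feasible h"
  shows "(\<Sum>i=1..m. h i \<bullet> (\<Sum>k=1..p. adjoint_on (H i) (L k i) (d k))) = (\<Sum>k=1..p. coupling k h \<bullet> d k)"
proof -
  have "(\<Sum>i=1..m. h i \<bullet> (\<Sum>k=1..p. adjoint_on (H i) (L k i) (d k)))
      = (\<Sum>i=1..m. \<Sum>k=1..p. L k i (h i) \<bullet> d k)"
    unfolding inner_sum_right
    by (intro sum.cong refl adjoint_on(2)[OF H L] feasibleD[OF assms])
  also have "\<dots> = (\<Sum>k=1..p. \<Sum>i=1..m. L k i (h i) \<bullet> d k)" by (rule sum.swap)
  also have "\<dots> = (\<Sum>k=1..p. coupling k h \<bullet> d k)" by (simp add: coupling_def inner_sum_left)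
  finally show ?thesis .
qed

lemma feasible_diff: "feasible x \<Longrightarrow> feasible y \<Longrightarrow> feasible (\<lambda>i. x i - y i)"
  unfolding feasible_def using hilbert_subspaceD(5)[OF H] by blast

lemma inner_partial_gradient:
  assumes "feasible x" "feasible y"
  shows "(\<Sum>i=1..m. partial_gradient x i \<bullet> (y i - x i))
    = (\<Sum>k=1..p. gradient (G k) (\<phi> k) (coupling k x) \<bullet> (coupling k y - coupling k x))"
  using inner_adjoint_sum[OF feasible_diff[OF assms(2,1)]] coupling_diff[OF assms(2,1)]
  by (simp add: partial_gradient_def inner_commute)

lemma smooth_part_lower:
  assumes "feasible x" "feasible y"
  shows "smooth_part x + (\<Sum>i=1..m. partial_gradient x i \<bullet> (y i - x i)) \<le> smooth_part y"
  unfolding inner_partial_gradient[OF assms] smooth_part_def sum.distrib[symmetric]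
  by (intro sum_mono convex_gradient_ineq G phi_diff phi_convex coupling_mem assms)

lemma smooth_part_upper:
  assumes "feasible x" "feasible y"
  shows "smooth_part y \<le> smooth_part x + (\<Sum>i=1..m. partial_gradient x i \<bullet> (y i - x i))
    + (\<Sum>k=1..p. \<tau> k / 2 * (norm (coupling k (\<lambda>i. y i - x i)))\<^sup>2)"
  unfolding inner_partial_gradient[OF assms] smooth_part_def sum.distrib[symmetric]
proof (rule sum_mono)
  fix k assume k: "k \<in> {1..p}"
  show "\<phi> k (coupling k y) \<le> \<phi> k (coupling k x)
      + gradient (G k) (\<phi> k) (coupling k x) \<bullet> (coupling k y - coupling k x)
      + \<tau> k / 2 * (norm (coupling k (\<lambda>i. y i - x i)))\<^sup>2"
    unfolding coupling_diff[OF assms(2,1) k]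
    by (intro lipschitz_gradient_descent G phi_diff phi_lipschitz coupling_mem assms k)
qed

lemma objective_eq: "objective m p f \<phi> L x = (\<Sum>i=1..m. f i (x i)) + ereal (smooth_part x)"
  by (simp add: objective_def smooth_part_def coupling_def)

text \<open>
  Each \<open>f j\<close> is finite somewhere, so the minimal value of the objective is less than \<open>\<infinity>\<close>.
\<close>

lemma solution_finite:
  assumes z: "is_solution m p H f \<phi> L z" and i: "i \<in> {1..m}"
  shows "f i (z i) \<noteq> \<infinity>"
proof
  assume inf: "f i (z i) = \<infinity>"
  obtain u where u: "\<And>j. j \<in> {1..m} \<Longrightarrow> u j \<in> H j \<and> f j (u j) \<noteq> \<infinity>"
    using Gamma0D(2)[OF f] by metis
  have "(\<Sum>j=1..m. f j (z j)) = \<infinity>" using inf i by (auto simp: sum_Pinfty)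
  moreover have "(\<Sum>j=1..m. f j (u j)) \<noteq> \<infinity>" using u by (auto simp: sum_Pinfty)
  ultimately have "objective m p f \<phi> L u < objective m p f \<phi> L z" by (simp add: objective_eq)
  moreover have "\<forall>j\<in>{1..m}. u j \<in> H j" using u by blast
  ultimately show False using z unfolding is_solution_def is_arg_min_def by blast
qed

text \<open>
  Fermat's rule. For necessity, only the component \<open>i\<close> is moved, from \<open>z i\<close> towards \<open>u\<close> by a
  fraction \<open>t\<close>: convexity bounds the change of \<open>f i\<close>, the descent inequality bounds the change of
  the smooth part up to a term of order \<open>t\<^sup>2\<close>, and division by \<open>t\<close> leaves the subgradient
  inequality in the limit. For sufficiency, the subgradient inequalities and the gradient
  inequality of the smooth part add up.
\<close>

theorem solution_iff_subgradients:
  "is_solution m p H f \<phi> L z \<longleftrightarrow>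
    feasible z \<and> (\<forall>i\<in>{1..m}. - partial_gradient z i \<in> subgradients (H i) (f i) (z i))"
proof (intro iffI conjI ballI)
  assume z: "is_solution m p H f \<phi> L z"
  then show feas: "feasible z" by (simp add: is_solution_def is_arg_min_def feasible_def)
  fix i assume i: "i \<in> {1..m}"
  note HD = hilbert_subspaceD[OF H[OF i]]
  have min: "objective m p f \<phi> L z \<le> objective m p f \<phi> L w" if "feasible w" for w
    using z that by (auto simp: is_solution_def is_arg_min_def feasible_def)
  define F where "F j = real_of_ereal (f j (z j))" for j
  have F: "f j (z j) = ereal (F j)" if "j \<in> {1..m}" for j
    using solution_finite[OF z that] Gamma0D(1)[OF f[OF that] feasibleD[OF feas that]]
    by (cases "f j (z j)") (auto simp: F_def)
  have ineq: "f i (z i) + ereal (- partial_gradient z i \<bullet> (u - z i)) \<le> f i u" if u: "u \<in> H i" for u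
  proof (cases "f i u")
    case (real b)
    define h where "h j = (if j = i then u - z i else 0)" for j
    define C where "C = (\<Sum>k=1..p. \<tau> k / 2 * (norm (L k i (u - z i)))\<^sup>2)"
    have step: "F i - b - partial_gradient z i \<bullet> (u - z i) \<le> t * C" if t: "0 < t" "t < 1" for t
    proof -
      define w where "w = z(i := z i + t *\<^sub>R (u - z i))"
      have ui: "u - z i \<in> H i" by (intro HD u feasibleD[OF feas i])
      have w: "feasible w"
        using feas HD(4)[OF feasibleD[OF feas i] HD(6)[OF ui]] by (auto simp: feasible_def w_def)
      have "ereal (sum F {1..m} + smooth_part z) = objective m p f \<phi> L z"
        by (simp add: objective_eq F)
      also have "\<dots> \<le> (\<Sum>j=1..m. f j (w j)) + ereal (smooth_part w)"
        using min[OF w] by (simp add: objective_eq)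
      also have "\<dots> \<le> (\<Sum>j=1..m. ereal (if j = i then (1 - t) * F i + t * b else F j)) + ereal (smooth_part w)"
      proof (intro add_right_mono sum_mono)
        fix j assume j: "j \<in> {1..m}"
        show "f j (w j) \<le> ereal (if j = i then (1 - t) * F i + t * b else F j)"
          using F[OF j] Gamma0_convexD[OF f[OF i] feasibleD[OF feas i] u F[OF i] real t]
          by (simp add: w_def)
      qed
      finally have "sum F {1..m} + smooth_part z
          \<le> (\<Sum>j=1..m. if j = i then (1 - t) * F i + t * b else F j) + smooth_part w" by simp
      also have "(\<Sum>j=1..m. if j = i then (1 - t) * F i + t * b else F j) = sum F {1..m} + t * (b - F i)"
        using i by (simp add: sum.remove[of _ i] algebra_simps)
      also have "smooth_part w \<le> smooth_part z + (\<Sum>j=1..m. partial_gradient z j \<bullet> (w j - z j))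
          + (\<Sum>k=1..p. \<tau> k / 2 * (norm (coupling k (\<lambda>j. w j - z j)))\<^sup>2)"
        by (rule smooth_part_upper[OF feas w])
      also have "(\<Sum>j=1..m. partial_gradient z j \<bullet> (w j - z j)) = t * (partial_gradient z i \<bullet> (u - z i))"
        using i by (simp add: sum.remove[of _ i] w_def)
      also have "(\<Sum>k=1..p. \<tau> k / 2 * (norm (coupling k (\<lambda>j. w j - z j)))\<^sup>2) = t\<^sup>2 * C"
      proof -
        have "coupling k (\<lambda>j. w j - z j) = t *\<^sub>R L k i (u - z i)" if k: "k \<in> {1..p}" for k
        proof -
          have "L k j (w j - z j) = (if j = i then t *\<^sub>R L k i (u - z i) else 0)" if "j \<in> {1..m}" for j
            using bounded_linear_onD(3)[OF L[OF k i] ui, of t]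
              bounded_linear_onD(3)[OF L[OF k that] feasibleD[OF feas that], of 0]
            by (auto simp: w_def)
          then show ?thesis using i by (simp add: coupling_def)
        qed
        then show ?thesis by (simp add: C_def sum_distrib_left power_mult_distrib mult_ac)
      qed
      finally have "0 \<le> t * (b - F i) + t * (partial_gradient z i \<bullet> (u - z i)) + t\<^sup>2 * C" by simp
      then have "t * (F i - b - partial_gradient z i \<bullet> (u - z i)) \<le> t * (t * C)"
        by (simp add: algebra_simps power2_eq_square)
      then show ?thesis using t by (simp add: mult_le_cancel_left_pos)
    qed
    have "((\<lambda>t. t * C) \<longlongrightarrow> 0 * C) (at_right 0)" by (intro tendsto_intros)
    moreover have "eventually (\<lambda>t. F i - b - partial_gradient z i \<bullet> (u - z i) \<le> t * C) (at_right 0)"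
      using step by (auto intro!: eventually_at_rightI[of 0 1])
    ultimately have "F i - b - partial_gradient z i \<bullet> (u - z i) \<le> 0 * C"
      by (intro tendsto_lowerbound) auto
    then show ?thesis using F[OF i] real by simp
  qed (use Gamma0D(1)[OF f[OF i] u] in auto)
  show "- partial_gradient z i \<in> subgradients (H i) (f i) (z i)"
    using ineq HD(7)[OF partial_gradient_mem[OF i]] F[OF i] by (simp add: subgradients_def)
next
  assume *: "feasible z \<and> (\<forall>i\<in>{1..m}. - partial_gradient z i \<in> subgradients (H i) (f i) (z i))"
  then have feas: "feasible z" and sub: "\<And>i. i \<in> {1..m} \<Longrightarrow> - partial_gradient z i \<in> subgradients (H i) (f i) (z i)"
    by auto
  define F where "F j = real_of_ereal (f j (z j))" for j
  have F: "f j (z j) = ereal (F j)" if "j \<in> {1..m}" for j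
    using sub[OF that] Gamma0D(1)[OF f[OF that] feasibleD[OF feas that]]
    by (cases "f j (z j)") (auto simp: F_def subgradients_def)
  have "objective m p f \<phi> L z \<le> objective m p f \<phi> L y" if y: "feasible y" for y
  proof -
    let ?s = "\<lambda>i. partial_gradient z i \<bullet> (y i - z i)"
    have "objective m p f \<phi> L z = ereal (sum F {1..m} + smooth_part z)" by (simp add: objective_eq F)
    also have "\<dots> \<le> ereal ((\<Sum>i=1..m. F i - ?s i) + smooth_part y)"
      using smooth_part_lower[OF feas y] by (simp add: sum_subtractf)
    also have "\<dots> = (\<Sum>i=1..m. ereal (F i - ?s i)) + ereal (smooth_part y)" by simp
    also have "\<dots> \<le> (\<Sum>i=1..m. f i (y i)) + ereal (smooth_part y)"
    proof (intro add_right_mono sum_mono)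
      fix i assume i: "i \<in> {1..m}"
      show "ereal (F i - ?s i) \<le> f i (y i)"
        using sub[OF i] feasibleD[OF y i] F[OF i] by (force simp: subgradients_def)
    qed
    finally show ?thesis by (simp add: objective_eq)
  qed
  then show "is_solution m p H f \<phi> L z"
    using feas unfolding is_solution_def is_arg_min_def feasible_def by (auto simp: not_less)
qed

text \<open>
  The inner product splits over \<open>k\<close> and is at least the sum of \<open>(norm (d k))\<^sup>2 / \<tau> k\<close> by the
  theorem of Baillon and Haddad, where \<open>d k\<close> is the difference of the gradients of \<open>\<phi> k\<close>. On the
  other side, \<open>(\<Sum>k=1..p. s k)\<^sup>2 \<le> p * (\<Sum>k=1..p. (s k)\<^sup>2)\<close> and the norms of the adjoints bound the
  squared norms by \<open>p\<close> times a weighted sum of the \<open>(norm (d k))\<^sup>2\<close>; comparing weights yields the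
  constant \<open>1 / (p * M)\<close>.
\<close>

lemma partial_gradient_cocoercive:
  assumes bound: "\<And>k. k \<in> {1..p} \<Longrightarrow> \<tau> k * (\<Sum>i=1..m. (onorm_on (H i) (L k i))\<^sup>2) \<le> M" and M: "0 < M"
    and x: "feasible x" and y: "feasible y"
  shows "1 / (real p * M) * (\<Sum>i=1..m. (norm (partial_gradient x i - partial_gradient y i))\<^sup>2)
    \<le> (\<Sum>i=1..m. (x i - y i) \<bullet> (partial_gradient x i - partial_gradient y i))"
proof -
  define d where "d k = gradient (G k) (\<phi> k) (coupling k x) - gradient (G k) (\<phi> k) (coupling k y)" for k
  let ?o = "\<lambda>k i. onorm_on (H i) (L k i)" and ?N = "\<lambda>k. (norm (d k))\<^sup>2"
  have diff: "partial_gradient x i - partial_gradient y i = (\<Sum>k=1..p. adjoint_on (H i) (L k i) (d k))"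
    if i: "i \<in> {1..m}" for i
    unfolding partial_gradient_def d_def sum_subtractf[symmetric]
    by (intro sum.cong refl adjoint_on_diff[OF H L, symmetric] i) auto
  have norm_sq: "(norm (partial_gradient x i - partial_gradient y i))\<^sup>2 \<le> real p * (\<Sum>k=1..p. (?o k i)\<^sup>2 * ?N k)"
    if i: "i \<in> {1..m}" for i
  proof -
    have "norm (partial_gradient x i - partial_gradient y i) \<le> (\<Sum>k=1..p. ?o k i * norm (d k))"
      unfolding diff[OF i] by (intro sum_norm_le adjoint_on(3)[OF H L] i)
    then have "(norm (partial_gradient x i - partial_gradient y i))\<^sup>2 \<le> (\<Sum>k=1..p. ?o k i * norm (d k))\<^sup>2"
      by (rule power_mono) simp
    also have "\<dots> \<le> (\<Sum>k=1..p. (?o k i * norm (d k))\<^sup>2) * real (card {1..p})"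
      by (rule sum_squared_le_sum_of_squares)
    finally show ?thesis by (simp add: power_mult_distrib mult.commute)
  qed
  have "(\<Sum>i=1..m. (norm (partial_gradient x i - partial_gradient y i))\<^sup>2)
      \<le> (\<Sum>i=1..m. real p * (\<Sum>k=1..p. (?o k i)\<^sup>2 * ?N k))" by (intro sum_mono norm_sq)
  also have "\<dots> = real p * (\<Sum>k=1..p. (\<Sum>i=1..m. (?o k i)\<^sup>2) * ?N k)"
    unfolding sum_distrib_left[symmetric] sum_distrib_right by (subst sum.swap) (rule refl)
  also have "\<dots> \<le> real p * (\<Sum>k=1..p. M * (?N k / \<tau> k))"
  proof (intro mult_left_mono sum_mono)
    fix k assume k: "k \<in> {1..p}"
    have "(\<Sum>i=1..m. (?o k i)\<^sup>2) \<le> M / \<tau> k"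
      using bound[OF k] tau[OF k] by (simp add: pos_le_divide_eq mult.commute)
    then have "(\<Sum>i=1..m. (?o k i)\<^sup>2) * ?N k \<le> M / \<tau> k * ?N k" by (rule mult_right_mono) simp
    then show "(\<Sum>i=1..m. (?o k i)\<^sup>2) * ?N k \<le> M * (?N k / \<tau> k)" by simp
  qed simp
  also have "\<dots> = real p * M * (\<Sum>k=1..p. ?N k / \<tau> k)" by (simp add: sum_distrib_left mult.assoc)
  finally have "1 / (real p * M) * (\<Sum>i=1..m. (norm (partial_gradient x i - partial_gradient y i))\<^sup>2)
      \<le> (\<Sum>k=1..p. ?N k / \<tau> k)"
    using M p by (simp add: pos_divide_le_eq mult.commute)
  also have "\<dots> \<le> (\<Sum>k=1..p. (coupling k x - coupling k y) \<bullet> d k)"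
    unfolding d_def
    by (intro sum_mono baillon_haddad G phi_diff phi_convex phi_lipschitz tau coupling_mem x y)
  also have "\<dots> = (\<Sum>k=1..p. coupling k (\<lambda>i. x i - y i) \<bullet> d k)" by (simp add: coupling_diff[OF x y])
  also have "\<dots> = (\<Sum>i=1..m. (x i - y i) \<bullet> (\<Sum>k=1..p. adjoint_on (H i) (L k i) (d k)))"
    by (rule inner_adjoint_sum[OF feasible_diff[OF x y], symmetric])
  also have "\<dots> = (\<Sum>i=1..m. (x i - y i) \<bullet> (partial_gradient x i - partial_gradient y i))"
    by (intro sum.cong refl) (simp only: diff)
  finally show ?thesis .
qed

end

section \<open>Weak convergence of the parallel splitting iteration\<close>

lemma summable_enn2real_bound:
  fixes S :: "nat \<Rightarrow> ennreal"
  assumes "(\<Sum>n. S n) < \<infinity>"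
  shows "summable (\<lambda>n. enn2real (S n))" "ennreal r \<le> S n \<Longrightarrow> r \<le> enn2real (S n)"
proof -
  have lt: "S n < top" for n using ennreal_suminf_lessD[of S] assms by (simp add: infinity_ennreal_def)
  then have eq: "ennreal (enn2real (S n)) = S n" for n by simp
  show "summable (\<lambda>n. enn2real (S n))"
    using assms by (intro summable_suminf_not_top) (auto simp: eq infinity_ennreal_def)
  show "r \<le> enn2real (S n)" if "ennreal r \<le> S n"
    using that eq[of n] by (metis enn2real_nonneg ennreal_le_iff)
qed

text \<open>
  \<open>S\<close> is the direct sum of the spaces \<open>H i\<close>. The sequence \<open>X\<close> collects the iterates in \<open>S\<close>. In it,
  the deviation of each relaxation parameter \<open>lami i n\<close> from \<open>lam n\<close> acts as an error proportional
  to the displacement, with the summable factor \<open>\<mu> n\<close>. Weak convergence in \<open>S\<close>, tested against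
  families with a single nonzero component, is weak convergence of every component.
\<close>

theorem theorem6p3:
  fixes m p :: nat
    and H :: "nat \<Rightarrow> 'h::real_inner set"
    and G :: "nat \<Rightarrow> 'g::real_inner set"
    and f :: "nat \<Rightarrow> 'h \<Rightarrow> ereal"
    and \<tau> :: "nat \<Rightarrow> real"
    and \<phi> :: "nat \<Rightarrow> 'g \<Rightarrow> real"
    and L :: "nat \<Rightarrow> nat \<Rightarrow> 'h \<Rightarrow> 'g"
    and \<beta> \<epsilon> :: real
    and \<gamma> lam :: "nat \<Rightarrow> real"
    and lami :: "nat \<Rightarrow> nat \<Rightarrow> real"
    and fn :: "nat \<Rightarrow> nat \<Rightarrow> 'h \<Rightarrow> ereal"
    and a b x :: "nat \<Rightarrow> nat \<Rightarrow> 'h"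
  assumes m: "m \<ge> 2" and p: "p \<ge> 1"
    and H: "\<And>i. i \<in> {1..m} \<Longrightarrow> hilbert_subspace (H i)"
    and G: "\<And>k. k \<in> {1..p} \<Longrightarrow> hilbert_subspace (G k)"
    and f: "\<And>i. i \<in> {1..m} \<Longrightarrow> f i \<in> Gamma0 (H i)"
    and tau: "\<And>k. k \<in> {1..p} \<Longrightarrow> \<tau> k > 0"
    and phi_convex: "\<And>k. k \<in> {1..p} \<Longrightarrow> convex_on (G k) (\<phi> k)"
    and phi_diff: "\<And>k. k \<in> {1..p} \<Longrightarrow> \<phi> k differentiable_on G k"
    and phi_lipschitz: "\<And>k. k \<in> {1..p} \<Longrightarrow> lipschitz_on (\<tau> k) (G k) (gradient (G k) (\<phi> k))"
    and L: "\<And>k i. k \<in> {1..p} \<Longrightarrow> i \<in> {1..m} \<Longrightarrow> bounded_linear_on (H i) (G k) (L k i)"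
    and L_nonzero: "Min ((\<lambda>k. \<Sum>i=1..m. (onorm_on (H i) (L k i))\<^sup>2) ` {1..p}) > 0"
    and has_solution: "\<exists>z. is_solution m p H f \<phi> L z"
    and beta: "\<beta> = 1 / (real p *
                  Max ((\<lambda>k. \<tau> k * (\<Sum>i=1..m. (onorm_on (H i) (L k i))\<^sup>2)) ` {1..p}))"
    and eps: "\<epsilon> \<in> {0<..<min 1 \<beta>}"
    and gamma: "\<And>n. \<gamma> n \<in> {\<epsilon>..2 * \<beta> - \<epsilon>}"
    and lam: "\<And>n. lam n \<in> {0..1 - \<epsilon>}"
    and x_init: "\<And>i. i \<in> {1..m} \<Longrightarrow> x i 0 \<in> H i"
    and x_step: "\<And>i n. i \<in> {1..m} \<Longrightarrow>
          x i (Suc n) = lami i n *\<^sub>R x i n + (1 - lami i n) *\<^sub>R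
            (prox (H i) (\<lambda>y. ereal (\<gamma> n) * fn i n y)
               (x i n - \<gamma> n *\<^sub>R
                  ((\<Sum>k=1..p. adjoint_on (H i) (L k i)
                       (gradient (G k) (\<phi> k) (\<Sum>j=1..m. L k j (x j n)))) + b i n))
             + a i n)"
    and fn: "\<And>i n. i \<in> {1..m} \<Longrightarrow> fn i n \<in> Gamma0 (H i)"
    and fn_approx: "\<And>i \<rho>. i \<in> {1..m} \<Longrightarrow> \<rho> > (0::real) \<Longrightarrow>
          (\<Sum>n. SUP y\<in>{y \<in> H i. norm y \<le> \<rho>}.
             ennreal (norm (prox (H i) (\<lambda>z. ereal (\<gamma> n) * fn i n z) y
                          - prox (H i) (\<lambda>z. ereal (\<gamma> n) * f i z) y))) < \<infinity>"
    and a_mem: "\<And>i n. i \<in> {1..m} \<Longrightarrow> a i n \<in> H i"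
    and b_mem: "\<And>i n. i \<in> {1..m} \<Longrightarrow> b i n \<in> H i"
    and a_summable: "\<And>i. i \<in> {1..m} \<Longrightarrow> summable (\<lambda>n. norm (a i n))"
    and b_summable: "\<And>i. i \<in> {1..m} \<Longrightarrow> summable (\<lambda>n. norm (b i n))"
    and lami: "\<And>i n. i \<in> {1..m} \<Longrightarrow> lami i n \<in> {0..<1}"
    and lami_summable: "\<And>i. i \<in> {1..m} \<Longrightarrow> summable (\<lambda>n. \<bar>lami i n - lam n\<bar>)"
  shows "\<exists>xs. (\<forall>i\<in>{1..m}. weakly_converges_on (H i) (x i) (xs i)) \<and> is_solution m p H f \<phi> L xs"
proof -
  let ?I = "{1..m}"
  define M where "M = Max ((\<lambda>k. \<tau> k * (\<Sum>i=1..m. (onorm_on (H i) (L k i))\<^sup>2)) ` {1..p})"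
  interpret coupled_problem m p H G f \<tau> \<phi> L
    by unfold_locales (fact p H G f tau phi_convex phi_diff phi_lipschitz L)+
  have M_ge: "\<tau> k * (\<Sum>i=1..m. (onorm_on (H i) (L k i))\<^sup>2) \<le> M" if "k \<in> {1..p}" for k
    unfolding M_def using that by (intro Max_ge) auto
  have M_pos: "0 < M"
  proof -
    have one: "1 \<in> {1..p}" using p by simp
    then have "0 < (\<Sum>i=1..m. (onorm_on (H i) (L 1 i))\<^sup>2)"
      using L_nonzero by (subst (asm) Min_gr_iff) auto
    then have "0 < \<tau> 1 * (\<Sum>i=1..m. (onorm_on (H i) (L 1 i))\<^sup>2)" using tau[OF one] by simp
    then show ?thesis using M_ge[OF one] by linarith
  qed
  have beta_eq: "\<beta> = 1 / (real p * M)" using beta by (simp add: M_def)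
  have eps_pos: "0 < \<epsilon>" and beta_pos: "0 < \<beta>" using eps by auto
  have \<gamma>_pos: "0 < \<gamma> n" for n using gamma[of n] eps_pos by auto
  note HD = hilbert_subspaceD[OF H]

  define S where "S = family_space ?I H"
  define B where "B u = family ?I (partial_gradient (component u))" for u
  define A where "A = {(u, v). u \<in> S \<and> v \<in> S \<and>
    (\<forall>i\<in>?I. component v i \<in> subgradients (H i) (f i) (component u i))}"
  have S_off: "component u i = 0" if "u \<in> S" "i \<notin> ?I" for u i using that by (auto simp: S_def family_space_def)
  have S_on: "component u i \<in> H i" if "u \<in> S" "i \<in> ?I" for u i using that by (auto simp: S_def family_space_def)
  have family_S: "family ?I v \<in> S" if "\<And>i. i \<in> ?I \<Longrightarrow> v i \<in> H i" for v
    using that by (auto simp: S_def family_space_def component_family)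
  have S_hilbert: "hilbert_subspace S" unfolding S_def by (intro hilbert_family_space H) auto
  note SD = hilbert_subspaceD[OF S_hilbert]
  have S_feasible: "feasible (component u)" if "u \<in> S" for u using S_on[OF that] by (auto simp: feasible_def)
  have inner_S: "u \<bullet> v = (\<Sum>i\<in>?I. component u i \<bullet> component v i)" if "u \<in> S" for u v
    using S_off[OF that] by (intro inner_on_family_space) auto
  have norm_S: "(norm u)\<^sup>2 = (\<Sum>i\<in>?I. (norm (component u i))\<^sup>2)" if "u \<in> S" for u
    using S_off[OF that] by (intro inner_on_family_space) auto
  have norm_le_S: "norm u \<le> (\<Sum>i\<in>?I. norm (component u i))" if "u \<in> S" for u
    using S_off[OF that] by (intro norm_le_sum_components) auto
  have BS: "B u \<in> S" for u unfolding B_def by (intro family_S partial_gradient_mem)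

  interpret monotone_inclusion S A B \<beta>
  proof
    show "hilbert_subspace S" by (rule S_hilbert)
    show "A \<subseteq> S \<times> S" by (auto simp: A_def)
    show "0 < \<beta>" by (rule beta_pos)
    show "B u \<in> S" for u by (rule BS)
    show "0 \<le> (q - r) \<bullet> (u - v)" if qu: "(q, u) \<in> A" and rv: "(r, v) \<in> A" for q u r v
    proof -
      have S4: "q \<in> S" "r \<in> S" "u \<in> S" "v \<in> S" using qu rv by (auto simp: A_def)
      have "(q - r) \<bullet> (u - v) = (\<Sum>i\<in>?I. (component q i - component r i) \<bullet> (component u i - component v i))"
        by (simp add: inner_S[OF SD(5)[OF S4(1,2)]] component_simps)
      also have "0 \<le> \<dots>"
      proof (rule sum_nonneg)
        fix i assume i: "i \<in> ?I"
        show "0 \<le> (component q i - component r i) \<bullet> (component u i - component v i)"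
          using qu rv i S4 by (intro subgradients_monotone[OF f[OF i]] S_on) (auto simp: A_def)
      qed
      finally show ?thesis .
    qed
    show "\<exists>q. (q, u - q) \<in> A" if u: "u \<in> S" for u
    proof -
      define q where "q = family ?I (\<lambda>i. prox (H i) (f i) (component u i))"
      have "q \<in> S" unfolding q_def by (intro family_S prox_is_subgradient(1)[OF H f] S_on[OF u])
      then have "(q, u - q) \<in> A"
        using prox_is_subgradient(2)[OF H f S_on[OF u]] SD(5)[OF u]
        by (auto simp: A_def q_def component_simps component_family)
      then show ?thesis ..
    qed
    show "\<beta> * (norm (B u - B v))\<^sup>2 \<le> (u - v) \<bullet> (B u - B v)" if uv: "u \<in> S" "v \<in> S" for u v
    proof -
      have "(norm (B u - B v))\<^sup>2
          = (\<Sum>i\<in>?I. (norm (partial_gradient (component u) i - partial_gradient (component v) i))\<^sup>2)"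
        unfolding norm_S[OF SD(5)[OF BS BS]] by (simp add: component_simps B_def component_family)
      moreover have "(u - v) \<bullet> (B u - B v) = (\<Sum>i\<in>?I. (component u i - component v i)
          \<bullet> (partial_gradient (component u) i - partial_gradient (component v) i))"
        unfolding inner_S[OF SD(5)[OF uv]] by (simp add: component_simps B_def component_family)
      ultimately show ?thesis
        using partial_gradient_cocoercive[OF M_ge M_pos S_feasible[OF uv(1)] S_feasible[OF uv(2)]]
        by (simp add: beta_eq)
    qed
  qed

  have zeros: "is_solution m p H f \<phi> L (component w)" if "(w, - B w) \<in> A" for w
    unfolding solution_iff_subgradients
    using that S_feasible by (auto simp: A_def component_simps B_def component_family)
  obtain z where z: "is_solution m p H f \<phi> L z" using has_solution by blast
  \<comment> \<open>setting the components outside the index set to \<open>0\<close> changes neither the objective nor its partial gradients\<close>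
  define Z where "Z = family ?I z"
  have Z: "(Z, - B Z) \<in> A"
  proof -
    have "Z \<in> S" unfolding Z_def using z by (intro family_S) (auto simp: solution_iff_subgradients feasible_def)
    moreover have "partial_gradient (component Z) i = partial_gradient z i" for i
      by (simp add: partial_gradient_def coupling_def Z_def component_family)
    ultimately show ?thesis
      using z SD(7)[OF BS] by (auto simp: A_def B_def component_simps component_family Z_def solution_iff_subgradients)
  qed

  have gradient_eq: "partial_gradient (\<lambda>i. x i n) i = (\<Sum>k=1..p. adjoint_on (H i) (L k i)
      (gradient (G k) (\<phi> k) (\<Sum>j=1..m. L k j (x j n))))" for i n
    by (simp add: partial_gradient_def coupling_def)
  define w where "w i n = x i n - \<gamma> n *\<^sub>R (partial_gradient (\<lambda>i. x i n) i + b i n)" for i n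
  define q where "q i n = prox (H i) (\<lambda>y. ereal (\<gamma> n) * fn i n y) (w i n)" for i n
  have step: "x i (Suc n) = lami i n *\<^sub>R x i n + (1 - lami i n) *\<^sub>R (q i n + a i n)" if "i \<in> ?I" for i n
    using x_step[OF that] by (simp add: q_def w_def gradient_eq)
  have w_mem: "w i n \<in> H i" if "i \<in> ?I" "x i n \<in> H i" for i n
    unfolding w_def using that by (intro HD partial_gradient_mem b_mem)
  have q_mem: "q i n \<in> H i" if "i \<in> ?I" "x i n \<in> H i" for i n
    unfolding q_def by (rule prox_scaled(1)[OF H[OF that(1)] fn[OF that(1)] \<gamma>_pos w_mem[OF that]])
  have x_mem: "x i n \<in> H i" if "i \<in> ?I" for i n
  proof (induction n)
    case 0
    then show ?case by (rule x_init[OF that])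
  next
    case (Suc n)
    then show ?case unfolding step[OF that] by (intro HD[OF that] q_mem[OF that] a_mem[OF that])
  qed

  define X where "X n = family ?I (\<lambda>i. x i n)" for n
  define b' where "b' n = family ?I (\<lambda>i. b i n)" for n
  define J where "J n u = family ?I (\<lambda>i. prox (H i) (\<lambda>y. ereal (\<gamma> n) * f i y) (component u i))" for n u
  define R where "R n u = family ?I (\<lambda>i. prox (H i) (\<lambda>y. ereal (\<gamma> n) * fn i n y) (component u i))" for n u
  define \<mu> where "\<mu> n = (\<Sum>i\<in>?I. \<bar>lami i n - lam n\<bar>)" for n
  define \<alpha> where "\<alpha> n = (\<Sum>i\<in>?I. norm (a i n))" for n
  have XS: "X n \<in> S" for n unfolding X_def by (intro family_S x_mem)
  have b'S: "b' n \<in> S" for n unfolding b'_def by (intro family_S b_mem)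
  have JS: "J n u \<in> S" if "u \<in> S" for n u
    unfolding J_def by (intro family_S prox_scaled(1) H f \<gamma>_pos S_on[OF that])
  have RS: "R n u \<in> S" if "u \<in> S" for n u
    unfolding R_def by (intro family_S prox_scaled(1) H fn \<gamma>_pos S_on[OF that])
  have pg_X: "partial_gradient (component (X n)) i = partial_gradient (\<lambda>i. x i n) i" for n i
    by (simp add: partial_gradient_def coupling_def X_def component_family)
  have W: "component (X n - \<gamma> n *\<^sub>R (B (X n) + b' n)) i = w i n" if "i \<in> ?I" for i n
    using that pg_X[of n i] by (simp add: component_simps w_def B_def component_family b'_def) (simp add: X_def component_family)
  have WS: "X n - \<gamma> n *\<^sub>R (B (X n) + b' n) \<in> S" for n by (intro SD XS BS b'S)
  have RW: "component (R n (X n - \<gamma> n *\<^sub>R (B (X n) + b' n))) i = q i n" if "i \<in> ?I" for i n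
    using that by (simp add: R_def component_family W q_def)

  obtain V where V: "(V, - B V) \<in> A" "weakly_converges_on S X V"
  proof (rule perturbed_forward_backward[of \<epsilon> \<gamma> lam Z X b' J R \<mu> \<alpha>])
    show "0 < \<epsilon>" by (rule eps_pos)
    show "\<gamma> n \<in> {\<epsilon>..2 * \<beta> - \<epsilon>}" "lam n \<in> {0..1 - \<epsilon>}" for n by (rule gamma, rule lam)
    show "(Z, - B Z) \<in> A" by (rule Z)
    show "X n \<in> S" "b' n \<in> S" for n by (rule XS, rule b'S)
    show "(J n u, (1 / \<gamma> n) *\<^sub>R (u - J n u)) \<in> A" if u: "u \<in> S" for n u
      using prox_scaled(2)[OF H f \<gamma>_pos S_on[OF u]] JS[OF u] SD(6)[OF SD(5)[OF u JS[OF u]]]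
      by (auto simp: A_def component_simps J_def component_family)
    show "norm (R n u - R n v) \<le> norm (u - v)" if u: "u \<in> S" and v: "v \<in> S" for n u v
    proof (rule power2_le_imp_le)
      show "(norm (R n u - R n v))\<^sup>2 \<le> (norm (u - v))\<^sup>2"
        unfolding norm_S[OF SD(5)[OF u v]] norm_S[OF SD(5)[OF RS[OF u] RS[OF v]]]
      proof (intro sum_mono power_mono)
        fix i assume i: "i \<in> ?I"
        show "norm (component (R n u - R n v) i) \<le> norm (component (u - v) i)"
          using prox_nonexpansive[OF H[OF i] Gamma0_scale[OF fn[OF i] \<gamma>_pos] S_on[OF u i] S_on[OF v i]] i
          by (simp add: component_simps R_def component_family)
      qed simp
    qed simp
    show "\<exists>\<delta>. summable \<delta> \<and> (\<forall>n. \<forall>u\<in>S. norm u \<le> \<rho> \<longrightarrow> norm (R n u - J n u) \<le> \<delta> n)" if \<rho>: "0 < \<rho>" for \<rho>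
    proof -
      define E where "E i n = (SUP y\<in>{y \<in> H i. norm y \<le> \<rho>}.
        ennreal (norm (prox (H i) (\<lambda>z. ereal (\<gamma> n) * fn i n z) y
          - prox (H i) (\<lambda>z. ereal (\<gamma> n) * f i z) y)))" for i n
      have E: "(\<Sum>n. E i n) < \<infinity>" if "i \<in> ?I" for i
        unfolding E_def by (rule fn_approx[OF that \<rho>])
      have "norm (R n u - J n u) \<le> (\<Sum>i\<in>?I. enn2real (E i n))" if u: "u \<in> S" "norm u \<le> \<rho>" for n u
      proof -
        have "norm (R n u - J n u) \<le> (\<Sum>i\<in>?I. norm (component (R n u - J n u) i))"
          by (intro norm_le_S SD(5) RS JS u)
        also have "\<dots> \<le> (\<Sum>i\<in>?I. enn2real (E i n))"
        proof (rule sum_mono)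
          fix i assume i: "i \<in> ?I"
          have "component u i \<in> {y \<in> H i. norm y \<le> \<rho>}"
            using S_on[OF u(1) i] norm_component_le[of u i] u(2) by auto
          then have "ennreal (norm (component (R n u - J n u) i)) \<le> E i n"
            unfolding E_def using i by (intro SUP_upper2) (auto simp: component_simps R_def J_def component_family)
          then show "norm (component (R n u - J n u) i) \<le> enn2real (E i n)"
            by (rule summable_enn2real_bound(2)[OF E[OF i]])
        qed
        finally show ?thesis .
      qed
      moreover have "summable (\<lambda>n. \<Sum>i\<in>?I. enn2real (E i n))"
        by (intro summable_sum summable_enn2real_bound(1) E)
      ultimately show ?thesis by blast
    qed
    show "norm (X (Suc n) - (lam n *\<^sub>R X n + (1 - lam n) *\<^sub>R R n (X n - \<gamma> n *\<^sub>R (B (X n) + b' n))))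
        \<le> \<mu> n * norm (X n - R n (X n - \<gamma> n *\<^sub>R (B (X n) + b' n))) + \<alpha> n" for n
    proof -
      let ?r = "R n (X n - \<gamma> n *\<^sub>R (B (X n) + b' n))"
      let ?d = "X (Suc n) - (lam n *\<^sub>R X n + (1 - lam n) *\<^sub>R ?r)"
      have "norm ?d \<le> (\<Sum>i\<in>?I. norm (component ?d i))"
        by (intro norm_le_S SD XS RS WS)
      also have "\<dots> \<le> (\<Sum>i\<in>?I. \<bar>lami i n - lam n\<bar> * norm (X n - ?r) + norm (a i n))"
      proof (rule sum_mono)
        fix i assume i: "i \<in> ?I"
        have X_comp: "component (X k) i = x i k" for k using i by (simp add: X_def component_family)
        have "component ?d i = x i (Suc n) - (lam n *\<^sub>R x i n + (1 - lam n) *\<^sub>R q i n)"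
          using i by (simp add: component_simps(2,4,5) RW[unfolded component_simps] X_comp)
        also have "\<dots> = (lami i n - lam n) *\<^sub>R (x i n - q i n) + (1 - lami i n) *\<^sub>R a i n"
          unfolding step[OF i] by (simp add: algebra_simps)
        finally have "norm (component ?d i) \<le> \<bar>lami i n - lam n\<bar> * norm (x i n - q i n) + \<bar>1 - lami i n\<bar> * norm (a i n)"
          by (metis norm_scaleR norm_triangle_ineq)
        moreover have "norm (x i n - q i n) \<le> norm (X n - ?r)"
          using norm_component_le[of "X n - ?r" i] RW[OF i, of n] by (simp add: component_simps(4) X_comp)
        then have "\<bar>lami i n - lam n\<bar> * norm (x i n - q i n) \<le> \<bar>lami i n - lam n\<bar> * norm (X n - ?r)"
          by (rule mult_left_mono) simp
        moreover have "\<bar>1 - lami i n\<bar> * norm (a i n) \<le> 1 * norm (a i n)"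
          using lami[OF i, of n] by (intro mult_right_mono) auto
        ultimately show "norm (component ?d i) \<le> \<bar>lami i n - lam n\<bar> * norm (X n - ?r) + norm (a i n)"
          by linarith
      qed
      also have "\<dots> = \<mu> n * norm (X n - ?r) + \<alpha> n"
        by (simp add: sum.distrib \<mu>_def \<alpha>_def sum_distrib_right)
      finally show ?thesis .
    qed
    show "0 \<le> \<mu> n" "0 \<le> \<alpha> n" for n by (simp_all add: \<mu>_def \<alpha>_def sum_nonneg)
    show "summable \<mu>" "summable \<alpha>"
      unfolding \<mu>_def \<alpha>_def by (intro summable_sum lami_summable a_summable; assumption)+
    have b'_le: "norm (norm (b' n)) \<le> (\<Sum>i\<in>?I. norm (b i n))" for n
      using norm_le_S[OF b'S] by (simp add: b'_def component_family)
    have "summable (\<lambda>n. \<Sum>i\<in>?I. norm (b i n))" by (rule summable_sum, rule b_summable)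
    from this b'_le show "summable (\<lambda>n. norm (b' n))" by (rule summable_comparison_test'[of _ 0])
  qed
  have "weakly_converges_on (H i) (x i) (component V i)" if i: "i \<in> ?I" for i
    unfolding weakly_converges_on_def
  proof (intro conjI ballI)
    have VS: "V \<in> S" using V(1) by (simp add: A_def)
    show "component V i \<in> H i" by (rule S_on[OF VS i])
    fix u assume u: "u \<in> H i"
    define U where "U = family ?I (\<lambda>j. if j = i then u else 0)"
    have "U \<in> S" unfolding U_def using u HD(3) by (intro family_S) auto
    then have "(\<lambda>n. X n \<bullet> U) \<longlonglongrightarrow> V \<bullet> U" using V(2) by (simp add: weakly_converges_on_def)
    moreover have "v \<bullet> U = component v i \<bullet> u" if "v \<in> S" for v
      using i by (simp add: inner_S[OF that] U_def component_family if_distrib[of "inner _"] cong: if_cong)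
    ultimately show "(\<lambda>n. x i n \<bullet> u) \<longlonglongrightarrow> component V i \<bullet> u"
      using XS VS i by (simp add: X_def component_family)
  qed
  then show ?thesis using zeros[OF V(1)] by blast
qed

end
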